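(* Let $R \in \mathbf{R} \cup \{\infty\}$ and $r \in \mathbf{R}$ be such that $R > r > 0$, and let $f$ be a function analytic on $D(0,R)$ and transcendental over $\mathbf{C}[z]$. There exists a constant $\gamma > 0$, depending only on $R$, $r$ and $f$, such that for every integer $D \geq 1$ there are infinitely many real numbers $N \geq 0$ for which $$\mathrm{card}\big(\Sigma_{D,N}(f,r)\big) < \gamma D^3 N^2.$$
   Context: $\overline{\mathbf{Q}}$ denotes the algebraic closure of $\mathbf{Q}$ in $\mathbf{C}$. For an algebraic number $\alpha$, $d(\alpha)$ denotes its degree over $\mathbf{Q}$, $M(\alpha)$ its Mahler measure (the Mahler measure of its minimal polynomial over $\mathbf{Z}$), and $h(\alpha) = \frac{1}{d(\alpha)} \log M(\alpha)$ its absolute logarithmic height. For $\rho>0$, $D(0,\rho)$ is the open disc $\{z \in \mathbf{C} : |z|<\rho\}$, with $D(0,\infty)=\mathbf{C}$, and $\overline{D(0,\rho)}$, for $\rho$ finite, is the closed disc. For $R \in \mathbf{R} \cup \{\infty\}$ and $r \in \mathbf{R}$ with $R > r > 0$, a function $f$ analytic (holomorphic) on $D(0,R)$, an integer $D \geq 1$ and a real number $N \geq 0$, $\Sigma_{D,N}(f,r)$ denotes the set of $\alpha \in \overline{\mathbf{Q}} \cap \overline{D(0,r)}$ such that $$f(\alpha) \in \overline{\mathbf{Q}}, \quad [\mathbf{Q}(\alpha, f(\alpha)) : \mathbf{Q}] \leq D, \quad h(\alpha) \leq N, \quad h(f(\alpha)) \leq N.$$ A function $f$ analytic on $D(0,R)$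 is transcendental over $\mathbf{C}[z]$ if there is no nonzero polynomial $P \in \mathbf{C}[X,Y]$ such that $P(z,f(z))$ is identically zero on $D(0,R)$. *)

theory Defs
  imports
    "HOL-Complex_Analysis.Complex_Analysis"
    "HOL-Algebra.Algebraic_Closure_Type"
    "HOL-Algebra.Embedded_Algebras"
    "HOL-Algebra.Generated_Fields"
    "Berlekamp_Zassenhaus.Square_Free_Factorization_Int"
    "Berlekamp_Zassenhaus.Mahler_Measure"
begin

text \<open>
  The minimal polynomial over the integers of an algebraic number: the irreducible element of
  \<open>\<int>[X]\<close> with positive leading coefficient that vanishes at the number. Irreducibility in
  \<open>\<int>[X]\<close> includes primitivity, since the polynomial is not constant.
\<close>

definition int_min_poly :: "complex \<Rightarrow> int poly" where
  "int_min_poly \<alpha> =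
     (THE p. Factorial_Ring.irreducible p \<and> Polynomial.lead_coeff p > 0 \<and> poly (map_poly of_int p) \<alpha> = 0)"

lemma int_min_poly_ex1:
  fixes \<alpha> :: complex
  assumes "algebraic \<alpha>"
  shows "\<exists>!p. Factorial_Ring.irreducible p \<and> Polynomial.lead_coeff p > 0 \<and>
           poly (map_poly of_int p) \<alpha> = 0"
proof (rule ex_ex1I)
  obtain p0 :: "complex poly" where p0: "\<And>i. Polynomial.coeff p0 i \<in> \<int>" "p0 \<noteq> 0" "poly p0 \<alpha> = 0"
    using assms unfolding Polynomial.algebraic_def by blast
  obtain q :: "int poly" where q: "p0 = map_poly of_int q"
  proof
    show "p0 = map_poly of_int (map_poly (\<lambda>z. floor (Re z)) p0)"
    proof (rule poly_eqI)
      fix n show "Polynomial.coeff p0 n = Polynomial.coeff (map_poly of_int (map_poly (\<lambda>z. floor (Re z)) p0)) n"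
        using p0(1)[of n] by (auto simp: coeff_map_poly elim!: Ints_cases)
    qed
  qed
  have "q \<noteq> 0" using p0 q by auto
  have "poly (map_poly of_int (prod_mset (prime_factorization q))) \<alpha> = 0"
  proof -
    have "q dvd prod_mset (prime_factorization q)"
      using prod_mset_prime_factorization_weak[OF \<open>q \<noteq> 0\<close>]
      by (metis dvd_normalize_iff dvd_refl)
    then obtain k where "prod_mset (prime_factorization q) = q * k" by (elim dvdE)
    thus ?thesis using p0(3) q by (simp add: of_int_poly_hom.hom_mult)
  qed
  moreover have "\<exists>a\<in>#A. poly (map_poly of_int a) \<alpha> = 0"
    if "poly (map_poly of_int (prod_mset A)) \<alpha> = 0" for A :: "int poly multiset"
    using that by (induction A) (auto simp: of_int_poly_hom.hom_mult)
  ultimately obtain a where a: "a \<in># prime_factorization q" "poly (map_poly of_int a) \<alpha> = 0"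
    by blast
  have irr: "Factorial_Ring.irreducible a"
    using a(1) by (intro prime_elem_imp_irreducible prime_imp_prime_elem) auto
  hence "a \<noteq> 0" by auto
  show "\<exists>p. Factorial_Ring.irreducible p \<and> Polynomial.lead_coeff p > 0 \<and>
           poly (map_poly of_int p) \<alpha> = 0"
  proof (cases "Polynomial.lead_coeff a > 0")
    case True then show ?thesis using irr a by blast
  next
    case False
    hence "Polynomial.lead_coeff (-a) > 0"
      using \<open>a \<noteq> 0\<close> by (simp add: order.strict_iff_order)
    moreover have "Factorial_Ring.irreducible (-a)"
      using irr irreducible_mult_unit_left[of "-1" a] by simp
    moreover have "poly (map_poly of_int (-a)) \<alpha> = 0" using a by (simp add: hom_distribs)
    ultimately show ?thesis by blast
  qed
next
  fix p q :: "int poly"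
  assume p: "Factorial_Ring.irreducible p \<and> Polynomial.lead_coeff p > 0 \<and> poly (map_poly of_int p) \<alpha> = 0"
    and q: "Factorial_Ring.irreducible q \<and> Polynomial.lead_coeff q > 0 \<and> poly (map_poly of_int q) \<alpha> = 0"
  have dvd: "p dvd q" if "Factorial_Ring.irreducible p" "poly (map_poly of_int p) \<alpha> = 0"
     "Factorial_Ring.irreducible q" "poly (map_poly of_int q) \<alpha> = 0" for p q :: "int poly"
  proof (rule ccontr)
    assume "\<not> p dvd q"
    hence cop: "Rings.coprime p q" using that(1) by (intro prime_elem_imp_coprime irreducible_imp_prime_elem_gcd)
    interpret rh: map_poly_comm_ring_hom "of_rat :: rat \<Rightarrow> complex"
      by unfold_locales (auto simp: of_rat_add of_rat_mult)
    let ?h = "of_int_poly :: int poly \<Rightarrow> rat poly"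
    have "gcd (?h p) (?h q) = 1"
      unfolding gcd_rat_to_gcd_int using cop by (simp add: coprime_iff_gcd_eq_1)
    then obtain u v where "u * ?h p + v * ?h q = 1"
      by (metis bezout_coefficients_fst_snd)
    hence "map_poly of_rat (u * ?h p + v * ?h q) = (1 :: complex poly)" by simp
    moreover have e: "map_poly of_rat (?h x) = (of_int_poly x :: complex poly)" for x
      by (rule poly_eqI) (simp add: coeff_map_poly)
    ultimately have "poly (map_poly of_rat u * of_int_poly p + map_poly of_rat v * of_int_poly q) \<alpha> = (1::complex)"
      by (simp add: rh.hom_add rh.hom_mult)
    thus False using that by simp
  qed
  have "p dvd q" "q dvd p" using dvd p q by auto
  then obtain c d where c: "q = p * c" and d: "p = q * d" by (elim dvdE)
  hence "p * (c * d) = p * 1" by (metis mult.assoc mult.right_neutral)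
  hence "c * d = 1" using p by (metis mult_left_cancel not_irreducible_zero)
  hence "is_unit c" by (metis dvd_triv_left)
  then obtain e where e: "c = [:e:]" "e dvd 1" by (metis is_unit_polyE)
  hence "e = 1 \<or> e = -1" by auto
  moreover have "Polynomial.lead_coeff q = Polynomial.lead_coeff p * e"
    unfolding c e(1) lead_coeff_mult by simp
  ultimately have "e = 1" using p q by auto
  thus "p = q" using c e(1) by (metis mult.right_neutral one_pCons)
qed

definition alg_degree :: "complex \<Rightarrow> nat" where
  "alg_degree \<alpha> = Polynomial.degree (int_min_poly \<alpha>)"

definition mahler_measure_alg :: "complex \<Rightarrow> real" where
  "mahler_measure_alg \<alpha> = mahler_measure (int_min_poly \<alpha>)"

definition abs_log_height :: "complex \<Rightarrow> real" where
  "abs_log_height \<alpha> = (1 / real (alg_degree \<alpha>)) * ln (mahler_measure_alg \<alpha>)"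

abbreviation complex_ring :: "complex ring" where
  "complex_ring \<equiv> ring_of_type_algebra"

lemma subfield_Rats_complex: "subfield \<rat> complex_ring"
proof -
  interpret C: Ring.field complex_ring by (rule field_from_type_algebra)
  have inv: "inv\<^bsub>complex_ring\<^esub> x = inverse x" if "x \<noteq> 0" for x :: complex
    using that by (intro C.comm_inv_char) (auto simp: ring_of_type_algebra_def)
  have mi: "\<ominus>\<^bsub>complex_ring\<^esub> x = - x" for x :: complex
    using C.minus_equality[of "-x" x] by (auto simp: ring_of_type_algebra_def)
  show ?thesis
  proof (rule C.subfieldI')
    show "subring \<rat> complex_ring"
      by (rule C.subringI) (auto simp: mi, auto simp: ring_of_type_algebra_def)
    show "\<And>k. k \<in> \<rat> - {\<zero>\<^bsub>complex_ring\<^esub>} \<Longrightarrow> inv\<^bsub>complex_ring\<^esub> k \<in> \<rat>"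
      using inv by (auto simp: ring_of_type_algebra_def)
  qed
qed

definition Q_adjoin :: "complex set \<Rightarrow> complex set" where
  "Q_adjoin S = generate_field complex_ring (\<rat> \<union> S)"

text \<open>
  The degree of \<open>K\<close> over the rationals. The operator \<open>ring.dim\<close> is meaningful only in finite
  dimension; below it is applied only to fields generated by finitely many algebraic numbers.
\<close>

definition degree_over_Q :: "complex set \<Rightarrow> nat" where
  "degree_over_Q K = ring.dim complex_ring \<rat> K"

definition Sigma_alg :: "nat \<Rightarrow> real \<Rightarrow> (complex \<Rightarrow> complex) \<Rightarrow> real \<Rightarrow> complex set" where
  "Sigma_alg D N f r =
     {\<alpha> \<in> cball 0 r. algebraic \<alpha> \<and> algebraic (f \<alpha>) \<and>
        degree_over_Q (Q_adjoin {\<alpha>, f \<alpha>}) \<le> D \<and>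
        abs_log_height \<alpha> \<le> N \<and> abs_log_height (f \<alpha>) \<le> N}"

text \<open>
  Elements of \<open>\<complex>[X,Y]\<close> are polynomials in \<open>Y\<close> with coefficients in \<open>\<complex>[X]\<close>.
\<close>

definition eval2 :: "complex poly poly \<Rightarrow> complex \<Rightarrow> complex \<Rightarrow> complex" where
  "eval2 P x y = poly (map_poly (\<lambda>c. poly c x) P) y"

definition transcendental_on :: "complex set \<Rightarrow> (complex \<Rightarrow> complex) \<Rightarrow> bool" where
  "transcendental_on S f \<longleftrightarrow>
     \<not> (\<exists>P :: complex poly poly. P \<noteq> 0 \<and> (\<forall>z\<in>S. eval2 P z (f z) = 0))"

end

(*
  Fix D. If the number of points of Sigma_{D,n} were at least gamma D^3 n^2 for all large n, put
  T = c D^2 N for a large N. By the pigeonhole principle there is a nonzero integer polynomial P of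
  degree < T in each variable, with coefficients at most 2^(TN), such that the first Taylor
  coefficients of F(z) = P(z, f(z)) are tiny; hence |F| is tiny on the disc of radius r. By
  Liouville's inequality F vanishes on Sigma_{D,N}. If F vanishes on Sigma_{D,n}, it has many zeros
  in the disc, the Schwarz lemma (dividing out Blaschke factors) makes |F| tiny again, and
  Liouville's inequality shows that F vanishes on Sigma_{D,n+1}. So F has infinitely many zeros in a
  compact disc and is identically zero, contradicting the transcendence of f.

  Liouville's inequality with the exponent D = [Q(a,b):Q] needs the norm of P(a,b) from Q(a,b). With
  a primitive element t and a = A(t), b = B(t), the norm is the product of P(A(s),B(s)) over the
  conjugates s of t; it is rational, and after multiplication by powers of the leading coefficients
  of the minimal polynomials of a and b it is an algebraic integer, hence a nonzero integer.
*)
theory Submission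
  imports Defs "Jordan_Normal_Form.Char_Poly"
begin

text \<open>The size of T is forced by counting bits. Put E = D T N. On
  \<open>Sigma_alg D N f r\<close> a nonzero value of F is at least 2^(-7 E), so about E Taylor
  coefficients have to be pushed below a fixed power of 2^(-E). This costs a multiple of E^2 bits,
  while T^2 coefficients of T N bits each supply T^3 N; hence T is a multiple of D^2 N. In the
  induction P stays fixed and the Schwarz lemma at level n asks for a multiple of D T n zeros, that
  is, of D^3 N n, and N \<le> n turns this into D^3 n^2. An exponent d(\<alpha>) d(f(\<alpha>)) in
  Liouville's inequality, which can reach D^2, would spoil the power of D; this is why the norm is
  taken from Q(\<alpha>, f(\<alpha>)). The induction needs many points at every level n \<ge> N, so
  the contradiction yields infinitely many good N, not all large ones. As R may be arbitrarily close
  to r, a zero must gain a factor below 1 for every pair r < r1; Blaschke factors do this, while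
  factors z - a would not. Almost all estimates are powers of 2 with natural exponents, so that
  comparing them is arithmetic in the natural numbers.\<close>

hide_const (open) up_ring.coeff up_ring.monom Polynomials.degree Polynomials.lead_coeff module.smult
  Divisibility.irreducible Divisibility.prime Coset.order

section \<open>Polynomials with coefficients in a subring of the complex numbers\<close>

text \<open>A predicate on sets, so that Q, Q(\<theta>), the algebraic integers and the rings
  \<open>stab V\<close> can all serve as coefficient domains inside the one type
  \<open>complex poly\<close>, where roots are always available.\<close>

definition csubring :: "complex set \<Rightarrow> bool" where
  "csubring A \<longleftrightarrow> 1 \<in> A \<and> (\<forall>x\<in>A. \<forall>y\<in>A. x - y \<in> A \<and> x * y \<in> A)"

definition csubfield :: "complex set \<Rightarrow> bool" where
  "csubfield A \<longleftrightarrow> csubring A \<and> (\<forall>x\<in>A. inverse x \<in> A)"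

definition coeffs_in :: "complex set \<Rightarrow> complex poly \<Rightarrow> bool" where
  "coeffs_in A p \<longleftrightarrow> (\<forall>i. coeff p i \<in> A)"

context
  fixes A :: "complex set"
  assumes A: "csubring A"
begin

lemma csubring_simps:
  shows csubring_1: "1 \<in> A" and csubring_0: "0 \<in> A"
    and csubring_diff: "x \<in> A \<Longrightarrow> y \<in> A \<Longrightarrow> x - y \<in> A"
    and csubring_mult: "x \<in> A \<Longrightarrow> y \<in> A \<Longrightarrow> x * y \<in> A"
    and csubring_uminus: "x \<in> A \<Longrightarrow> - x \<in> A"
    and csubring_add: "x \<in> A \<Longrightarrow> y \<in> A \<Longrightarrow> x + y \<in> A"
proof -
  show 1: "1 \<in> A" and d: "\<And>x y. x \<in> A \<Longrightarrow> y \<in> A \<Longrightarrow> x - y \<in> A"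
    and "x \<in> A \<Longrightarrow> y \<in> A \<Longrightarrow> x * y \<in> A" for x y
    using A by (auto simp: csubring_def)
  show 0: "0 \<in> A" using d[OF 1 1] by simp
  show u: "- x \<in> A" if "x \<in> A" for x using d[OF 0 that] by simp
  show "x + y \<in> A" if "x \<in> A" "y \<in> A" for x y using d[OF that(1) u[OF that(2)]] by simp
qed

lemma csubring_power: "x \<in> A \<Longrightarrow> x ^ n \<in> A"
  by (induction n) (auto intro: csubring_simps)

lemma csubring_sum: "(\<And>i. i \<in> I \<Longrightarrow> f i \<in> A) \<Longrightarrow> sum f I \<in> A"
  by (induction I rule: infinite_finite_induct) (auto intro: csubring_simps)

lemma csubring_prod: "(\<And>i. i \<in> I \<Longrightarrow> f i \<in> A) \<Longrightarrow> prod f I \<in> A"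
  by (induction I rule: infinite_finite_induct) (auto intro: csubring_simps)

lemma csubring_of_int: "of_int n \<in> A"
proof -
  have "of_nat k \<in> A" for k by (induction k) (auto intro: csubring_simps)
  thus ?thesis by (cases n rule: int_cases2) (auto intro: csubring_simps)
qed

lemma coeffs_in_const: "c \<in> A \<Longrightarrow> coeffs_in A [:c:]"
  by (auto simp: coeffs_in_def coeff_pCons csubring_0 split: nat.splits)

lemma coeffs_in_0: "coeffs_in A 0"
  by (auto simp: coeffs_in_def csubring_0)

lemma coeffs_in_1: "coeffs_in A 1"
  using coeffs_in_const[OF csubring_1] by (metis one_pCons)

lemma coeffs_in_pCons: "c \<in> A \<Longrightarrow> coeffs_in A p \<Longrightarrow> coeffs_in A (pCons c p)"
  unfolding coeffs_in_def by (metis coeff_pCons_0 coeff_pCons_Suc not0_implies_Suc)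

lemma coeffs_in_monom: "c \<in> A \<Longrightarrow> coeffs_in A (monom c n)"
  unfolding coeffs_in_def by (metis coeff_monom csubring_0)

lemma coeffs_in_add: "coeffs_in A p \<Longrightarrow> coeffs_in A q \<Longrightarrow> coeffs_in A (p + q)"
  by (auto simp: coeffs_in_def csubring_add)

lemma coeffs_in_diff: "coeffs_in A p \<Longrightarrow> coeffs_in A q \<Longrightarrow> coeffs_in A (p - q)"
  by (auto simp: coeffs_in_def csubring_diff)

lemma coeffs_in_mult: "coeffs_in A p \<Longrightarrow> coeffs_in A q \<Longrightarrow> coeffs_in A (p * q)"
  by (auto simp: coeffs_in_def coeff_mult intro!: csubring_sum csubring_mult)

lemma coeffs_in_smult: "c \<in> A \<Longrightarrow> coeffs_in A q \<Longrightarrow> coeffs_in A (smult c q)"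
  by (auto simp: coeffs_in_def intro!: csubring_mult)

lemma coeffs_in_power: "coeffs_in A p \<Longrightarrow> coeffs_in A (p ^ n)"
  by (induction n) (auto intro: coeffs_in_mult coeffs_in_1)

lemma coeffs_in_sum: "(\<And>i. i \<in> I \<Longrightarrow> coeffs_in A (f i)) \<Longrightarrow> coeffs_in A (sum f I)"
  by (induction I rule: infinite_finite_induct) (auto intro: coeffs_in_add coeffs_in_0)

lemma coeffs_in_pcompose:
  "coeffs_in A p \<Longrightarrow> coeffs_in A q \<Longrightarrow> coeffs_in A (pcompose p q)"
proof (induction p)
  case (pCons a p)
  have "a \<in> A" using pCons.prems(1) by (auto simp: coeffs_in_def dest: spec[of _ 0])
  moreover have "coeffs_in A p"
    unfolding coeffs_in_def using pCons.prems(1) by (metis coeff_pCons_Suc coeffs_in_def)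
  ultimately show ?case using pCons
    by (auto simp: pcompose_pCons intro!: coeffs_in_add coeffs_in_mult coeffs_in_const)
qed (auto intro: coeffs_in_0)

lemma poly_in: "coeffs_in A p \<Longrightarrow> x \<in> A \<Longrightarrow> poly p x \<in> A"
  by (auto simp: poly_altdef coeffs_in_def intro!: csubring_sum csubring_mult csubring_power)

lemma coeffs_in_division:
  assumes m: "coeffs_in A m" "lead_coeff m = 1" and p: "coeffs_in A p"
  shows "\<exists>q r. coeffs_in A q \<and> coeffs_in A r \<and> p = q * m + r \<and> (r = 0 \<or> degree r < degree m)"
  using p
proof (induction "degree p" arbitrary: p rule: less_induct)
  case less
  show ?case
  proof (cases "p = 0 \<or> degree p < degree m")
    case True
    thus ?thesis using less.prems by (intro exI[of _ 0] exI[of _ p]) (auto intro: coeffs_in_0)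
  next
    case False
    define t where "t = monom (lead_coeff p) (degree p - degree m)"
    have t: "coeffs_in A t" unfolding t_def
      using less.prems by (intro coeffs_in_monom) (auto simp: coeffs_in_def)
    define p' where "p' = p - t * m"
    have p'_in: "coeffs_in A p'" unfolding p'_def
      by (intro coeffs_in_diff coeffs_in_mult t m less.prems)
    have "m \<noteq> 0" using m by auto
    have degtm: "degree (t * m) = degree p"
      using False \<open>m \<noteq> 0\<close> by (subst degree_mult_eq) (auto simp: t_def degree_monom_eq)
    have lctm: "lead_coeff (t * m) = lead_coeff p"
      using m by (simp only: lead_coeff_mult t_def lead_coeff_monom mult_1_right)
    have "p' = 0 \<or> degree p' < degree p"
      unfolding p'_def using degtm lctm
      by (metis coeff_diff degree_diff_le eq_iff_diff_eq_0 le_refl leading_coeff_0_iff order_le_less)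
    thus ?thesis
    proof
      assume "p' = 0"
      thus ?thesis using t by (intro exI[of _ t] exI[of _ 0]) (auto simp: p'_def intro: coeffs_in_0)
    next
      assume "degree p' < degree p"
      from less.hyps[OF this p'_in] obtain q r where qr: "coeffs_in A q" "coeffs_in A r"
        "p' = q * m + r" "r = 0 \<or> degree r < degree m" by blast
      thus ?thesis using t
        by (intro exI[of _ "t + q"] exI[of _ r])
           (auto simp: p'_def algebra_simps intro: coeffs_in_add)
    qed
  qed
qed

text \<open>Brings a divisibility in C[X] back to A[X]: the remainder computed over A is divisible
  by m in C[X], hence zero for degree reasons.\<close>

lemma coeffs_in_dvd:
  assumes m: "coeffs_in A m" "lead_coeff m = 1" and p: "coeffs_in A p" and "m dvd p"
  obtains q where "coeffs_in A q" "p = q * m"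
proof -
  obtain q r where qr: "coeffs_in A q" "p = q * m + r" "r = 0 \<or> degree r < degree m"
    using coeffs_in_division[OF m p] by blast
  have "m dvd r" using \<open>m dvd p\<close> qr(2) by (simp add: dvd_add_right_iff)
  hence "r = 0" using qr(3) dvd_imp_degree_le[of m r] by linarith
  thus ?thesis using qr that by auto
qed

end

text \<open>A monic element w of least degree in the ideal generated by p and q over F divides both,
  since remainders modulo w lie in the ideal again. Coefficients in F together with divisibility in
  C[X] are what links roots in C to the smaller field.\<close>

lemma csubfield_bezout:
  assumes F: "csubfield F" and p: "coeffs_in F p" and q: "coeffs_in F q" and "p \<noteq> 0"
  obtains u v w where "coeffs_in F u" "coeffs_in F v" "coeffs_in F w" "lead_coeff w = 1"
    "w = u * p + v * q" "w dvd p" "w dvd q"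
proof -
  have R: "csubring F" using F by (simp add: csubfield_def)
  define I where "I = {w. w \<noteq> 0 \<and> (\<exists>u v. coeffs_in F u \<and> coeffs_in F v \<and> w = u * p + v * q)}"
  have pq: "\<exists>u v. coeffs_in F u \<and> coeffs_in F v \<and> p = u * p + v * q"
    "\<exists>u v. coeffs_in F u \<and> coeffs_in F v \<and> q = u * p + v * q"
    using coeffs_in_0[OF R] coeffs_in_1[OF R]
    by (intro exI[of _ 1] exI[of _ 0], simp, intro exI[of _ 0] exI[of _ 1], simp)
  have "p \<in> I" using \<open>p \<noteq> 0\<close> pq unfolding I_def by blast
  then obtain w0 where w0: "w0 \<in> I" and min: "\<And>y. y \<in> I \<Longrightarrow> degree w0 \<le> degree y"
    using ex_has_least_nat[of "\<lambda>w. w \<in> I" p degree] by auto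
  obtain u0 v0 where uv0: "coeffs_in F u0" "coeffs_in F v0" "w0 = u0 * p + v0 * q" "w0 \<noteq> 0"
    using w0 by (auto simp: I_def)
  define c where "c = inverse (lead_coeff w0)"
  have w0F: "coeffs_in F w0" unfolding uv0(3)
    by (intro coeffs_in_add coeffs_in_mult R uv0 p q)
  have cF: "c \<in> F" using w0F F by (auto simp: c_def csubfield_def coeffs_in_def)
  have c0: "c \<noteq> 0" using uv0(4) by (auto simp: c_def)
  define w where "w = smult c w0"
  have wF: "coeffs_in F w" unfolding w_def by (intro coeffs_in_smult R cF w0F)
  have lc: "lead_coeff w = 1" using uv0(4) by (simp add: w_def c_def)
  have weq: "w = smult c u0 * p + smult c v0 * q"
    unfolding w_def uv0(3) by (simp add: smult_add_right)
  have dvd: "w dvd z" if z: "coeffs_in F z" "\<exists>u v. coeffs_in F u \<and> coeffs_in F v \<and> z = u * p + v * q" for z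
  proof -
    obtain k r where kr: "coeffs_in F k" "coeffs_in F r" "z = k * w + r" "r = 0 \<or> degree r < degree w"
      using coeffs_in_division[OF R wF lc z(1)] by blast
    obtain u v where uv: "coeffs_in F u" "coeffs_in F v" "z = u * p + v * q" using z(2) by blast
    have "r = (u - k * smult c u0) * p + (v - k * smult c v0) * q"
      using kr(3) unfolding uv(3) weq by (simp add: algebra_simps)
    moreover have "coeffs_in F (u - k * smult c u0)" "coeffs_in F (v - k * smult c v0)"
      by (intro coeffs_in_diff coeffs_in_mult coeffs_in_smult R kr uv uv0 cF)+
    ultimately have "r \<in> I" if "r \<noteq> 0" using that unfolding I_def by blast
    moreover have "degree w = degree w0" using c0 by (simp add: w_def)
    ultimately have "r = 0" using min kr(4) by (metis not_le)
    thus ?thesis using kr by simp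
  qed
  show ?thesis
  proof (rule that[OF _ _ wF lc weq])
    show "coeffs_in F (smult c u0)" "coeffs_in F (smult c v0)" by (intro coeffs_in_smult R uv0 cF)+
    show "w dvd p" "w dvd q" using dvd p q pq by blast+
  qed
qed

section \<open>Minimal polynomials over the rationals and conjugates\<close>

lemma csubfield_Rats: "csubfield \<rat>"
  by (auto simp: csubfield_def csubring_def)

lemma csubring_Rats: "csubring \<rat>"
  using csubfield_Rats by (simp add: csubfield_def)

text \<open>Irreducibility is replaced by the property of generating the ideal of rational
  polynomials that vanish at x. Here \<open>dvd\<close> refers to C[X]; for monic rational m this
  amounts to the same by \<open>coeffs_in_dvd\<close>.\<close>

definition is_min_poly :: "complex poly \<Rightarrow> complex \<Rightarrow> bool" where
  "is_min_poly m x \<longleftrightarrow> coeffs_in \<rat> m \<and> lead_coeff m = 1 \<and> poly m x = 0 \<and>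
     (\<forall>p. coeffs_in \<rat> p \<longrightarrow> poly p x = 0 \<longrightarrow> m dvd p)"

lemma is_min_polyD:
  assumes "is_min_poly m x"
  shows "coeffs_in \<rat> m" "lead_coeff m = 1" "poly m x = 0" "m \<noteq> 0"
    "\<And>p. coeffs_in \<rat> p \<Longrightarrow> poly p x = 0 \<Longrightarrow> m dvd p"
  using assms unfolding is_min_poly_def by auto

lemma ex_min_poly:
  assumes "algebraic x"
  obtains m where "is_min_poly m x"
proof -
  define I where "I = {p. p \<noteq> 0 \<and> coeffs_in \<rat> p \<and> poly p x = 0}"
  obtain p0 where p0: "\<And>i. coeff p0 i \<in> \<int>" "p0 \<noteq> 0" "poly p0 x = 0"
    using assms unfolding Polynomial.algebraic_def by blast
  have "p0 \<in> I" using p0 Ints_subset_Rats by (auto simp: I_def coeffs_in_def)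
  then obtain w where w: "w \<in> I" and min: "\<And>y. y \<in> I \<Longrightarrow> degree w \<le> degree y"
    using ex_has_least_nat[of "\<lambda>w. w \<in> I" p0 degree] by auto
  define m where "m = smult (inverse (lead_coeff w)) w"
  have m: "coeffs_in \<rat> m" "lead_coeff m = 1" "poly m x = 0" "degree m = degree w"
    using w unfolding m_def I_def by (auto simp: coeffs_in_def)
  have "m dvd p" if p: "coeffs_in \<rat> p" "poly p x = 0" for p
  proof -
    obtain q r where qr: "coeffs_in \<rat> q" "coeffs_in \<rat> r" "p = q * m + r" "r = 0 \<or> degree r < degree m"
      using coeffs_in_division[OF csubring_Rats m(1,2) p(1)] by blast
    have "poly r x = 0" using p(2) qr(3) m(3) by simp
    hence "r \<in> I" if "r \<noteq> 0" using that qr(2) unfolding I_def by blast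
    hence "r = 0" using min qr(4) m(4) by (metis not_le)
    thus ?thesis using qr by simp
  qed
  thus ?thesis using that m(1-3) unfolding is_min_poly_def by blast
qed

text \<open>Irreducibility in disguise. The gcd w of m and p over Q vanishes at y, so it is not
  constant. If the cofactor of w in m vanished at x, then m would divide it and w would be constant;
  so w vanishes at x, and m divides w, hence p.\<close>

lemma is_min_poly_conjugate:
  assumes m: "is_min_poly m x" and y: "poly m y = 0"
  shows "is_min_poly m y"
proof -
  note D = is_min_polyD[OF m]
  have "m dvd p" if p: "coeffs_in \<rat> p" "poly p y = 0" for p
  proof -
    obtain u v w where w: "coeffs_in \<rat> u" "coeffs_in \<rat> v" "coeffs_in \<rat> w" "lead_coeff w = 1"
      "w = u * m + v * p" "w dvd m" "w dvd p"
      using csubfield_bezout[OF csubfield_Rats D(1) p(1) D(4)] by blast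
    obtain h where h: "coeffs_in \<rat> h" "m = h * w"
      using coeffs_in_dvd[OF csubring_Rats w(3,4) D(1) w(6)] by blast
    have wy: "poly w y = 0" using p y w(5) by simp
    have "poly w x = 0"
    proof (rule ccontr)
      assume "poly w x \<noteq> 0"
      moreover have "poly h x * poly w x = 0" using D(3) h(2) by (metis poly_mult)
      ultimately have "m dvd h" using D(5)[OF h(1)] by simp
      moreover have "h \<noteq> 0" "w \<noteq> 0" using h(2) D(4) by (metis mult_zero_left, metis h(2) D(4) mult_zero_right)
      ultimately have "degree m \<le> degree h" by (simp add: dvd_imp_degree_le)
      hence "degree w = 0" 
        using degree_mult_eq[OF \<open>h \<noteq> 0\<close> \<open>w \<noteq> 0\<close>] unfolding h(2) by simp
      then obtain c where "w = [:c:]" by (rule degree_eq_zeroE)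
      thus False using w(4) wy by auto
    qed
    thus ?thesis using D(5)[OF w(3)] w(7) by (meson dvd_trans)
  qed
  thus ?thesis using D(1,2) y unfolding is_min_poly_def by blast
qed

section \<open>Algebraic integers\<close>

interpretation int_mod: Modules.module "\<lambda>(c::int) (x::complex). of_int c * x"
  by unfold_locales (auto simp: algebra_simps)

text \<open>The determinant trick: on the generators V, multiplication by x is given by an integer
  matrix, and x is an eigenvalue of it, hence a root of its monic integral characteristic
  polynomial.\<close>

lemma algebraic_int_if_stable_span:
  assumes fin: "finite V" and v0: "v0 \<in> V" "v0 \<noteq> 0"
    and stable: "\<And>v. v \<in> V \<Longrightarrow> x * v \<in> int_mod.span V"
  shows "algebraic_int x"
proof -
  obtain e where e: "bij_betw e {..<card V} V"
    using ex_bij_betw_nat_finite[OF fin] by (auto simp: atLeast0LessThan)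
  define n where "n = card V"
  have "\<exists>u::complex \<Rightarrow> int. x * v = (\<Sum>w\<in>V. of_int (u w) * w)" if "v \<in> V" for v
    using stable[OF that] unfolding int_mod.span_finite[OF fin] by auto
  then obtain u :: "complex \<Rightarrow> complex \<Rightarrow> int"
    where u: "\<And>v. v \<in> V \<Longrightarrow> x * v = (\<Sum>w\<in>V. of_int (u v w) * w)" by metis
  \<comment> \<open>V may be linearly dependent over Z, so this matrix is a choice; any choice has
    the vector of generators as an eigenvector, which is nonzero because of
    \<open>v0\<close>.\<close>
  define M where "M = mat n n (\<lambda>(i,j). u (e i) (e j))"
  have M: "M \<in> carrier_mat n n" by (simp add: M_def)
  define A :: "complex mat" where "A = map_mat of_int M"
  have A: "A \<in> carrier_mat n n" using M by (simp add: A_def)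
  define w where "w = vec n e"
  have "A *\<^sub>v w = x \<cdot>\<^sub>v w"
  proof (rule eq_vecI)
    fix i assume "i < dim_vec (x \<cdot>\<^sub>v w)"
    hence i: "i < n" by (simp add: w_def)
    have ei: "e i \<in> V" using i bij_betw_apply[OF e] by (simp add: n_def)
    have "(A *\<^sub>v w) $ i = (\<Sum>j<n. of_int (u (e i) (e j)) * e j)"
      using i by (simp add: A_def M_def w_def scalar_prod_def atLeast0LessThan)
    also have "\<dots> = (\<Sum>v\<in>V. of_int (u (e i) v) * v)"
      unfolding n_def using e by (rule sum.reindex_bij_betw)
    also have "\<dots> = (x \<cdot>\<^sub>v w) $ i" using u[OF ei] i by (simp add: w_def)
    finally show "(A *\<^sub>v w) $ i = (x \<cdot>\<^sub>v w) $ i" .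
  qed (use A in \<open>auto simp: w_def\<close>)
  moreover have "w \<noteq> 0\<^sub>v n"
  proof
    assume w: "w = 0\<^sub>v n"
    have "v0 \<in> e ` {..<n}" using v0(1) bij_betw_imp_surj_on[OF e] by (simp add: n_def)
    then obtain i where "i < n" "e i = v0" by auto
    hence "w $ i = v0" by (simp add: w_def)
    thus False using \<open>i < n\<close> v0(2) unfolding w by simp
  qed
  ultimately have "eigenvector A w x" using A by (auto simp: eigenvector_def w_def)
  hence "eigenvalue A x" by (auto simp: eigenvalue_def)
  hence "poly (char_poly A) x = 0" using eigenvalue_root_char_poly[OF A] by simp
  moreover have "char_poly A = map_poly of_int (char_poly M)"
    unfolding A_def by (rule of_int_hom.char_poly_hom[OF M])
  moreover have "lead_coeff (char_poly M) = 1" using degree_monic_char_poly[OF M] by simp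
  ultimately show ?thesis unfolding algebraic_int_altdef_ipoly
    by (intro exI[of _ "char_poly M"] conjI) simp_all
qed

text \<open>The multiplier ring of the Z-module generated by V. For finite V with a nonzero element
  it consists of algebraic integers, and being a ring it handles several of them at once.\<close>

definition stab :: "complex set \<Rightarrow> complex set" where
  "stab V = {y. \<forall>v\<in>V. y * v \<in> int_mod.span V}"

lemma stab_span:
  assumes "y \<in> stab V" "u \<in> int_mod.span V"
  shows "y * u \<in> int_mod.span V"
  using assms(2)
proof (induction rule: int_mod.span_induct_alt)
  case base
  show ?case by (simp add: int_mod.span_zero)
next
  case (step c v z)
  have "y * v \<in> int_mod.span V" using assms(1) step by (auto simp: stab_def)
  hence "of_int c * (y * v) + y * z \<in> int_mod.span V"
    by (intro int_mod.span_add int_mod.span_scale step)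
  thus ?case by (simp add: algebra_simps)
qed

lemma csubring_stab: "csubring (stab V)"
  unfolding csubring_def
proof (intro conjI ballI)
  show "1 \<in> stab V" by (auto simp: stab_def int_mod.span_base)
  fix x y assume x: "x \<in> stab V" and y: "y \<in> stab V"
  show "x - y \<in> stab V" using x y
    by (auto simp: stab_def left_diff_distrib intro: int_mod.span_diff)
  show "x * y \<in> stab V" using stab_span[OF x] y
    by (auto simp: stab_def mult.assoc)
qed

text \<open>The new generators are y^j v with j below the degree m of p. Multiplication by y raises
  j, and the equation of y brings y^m back into the span; old multipliers survive because they
  commute with powers of y.\<close>

lemma stab_extend:
  assumes fin: "finite V" and v0: "v0 \<in> V" "v0 \<noteq> 0"
    and p: "coeffs_in (stab V) p" "lead_coeff p = 1" "poly p y = 0"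
  obtains V' v0' where "finite V'" "v0' \<in> V'" "v0' \<noteq> 0" "stab V \<subseteq> stab V'" "y \<in> stab V'"
proof -
  define m where "m = degree p"
  have "m > 0"
  proof (rule ccontr)
    assume "\<not> m > 0"
    then obtain c where "p = [:c:]" by (auto simp: m_def elim: degree_eq_zeroE)
    thus False using p(2,3) by simp
  qed
  define V' where "V' = (\<lambda>(j,v). y ^ j * v) ` ({..<m} \<times> V)"
  have in_V': "y ^ j * v \<in> V'" if "j < m" "v \<in> V" for j v
    using that by (force simp: V'_def)
  have span_pow: "y ^ j * u \<in> int_mod.span V'" if "j < m" "u \<in> int_mod.span V" for j u
    using that(2)
  proof (induction rule: int_mod.span_induct_alt)
    case base
    show ?case by (simp add: int_mod.span_zero)
  next
    case (step c v z)
    have "y ^ j * v \<in> int_mod.span V'" using in_V'[OF that(1) step(1)] by (rule int_mod.span_base)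
    hence "of_int c * (y ^ j * v) + y ^ j * z \<in> int_mod.span V'"
      by (intro int_mod.span_add int_mod.span_scale step)
    thus ?case by (simp add: algebra_simps)
  qed
  have sub: "stab V \<subseteq> stab V'"
  proof
    fix z assume z: "z \<in> stab V"
    have "z * (y ^ j * v) \<in> int_mod.span V'" if "j < m" "v \<in> V" for j v
    proof -
      have "y ^ j * (z * v) \<in> int_mod.span V'"
        using span_pow[OF that(1)] z that(2) by (auto simp: stab_def)
      thus ?thesis by (simp add: mult_ac)
    qed
    thus "z \<in> stab V'" by (auto simp: stab_def V'_def)
  qed
  have ym: "y ^ m = (\<Sum>j<m. - coeff p j * y ^ j)"
  proof -
    have "0 = (\<Sum>j\<le>m. coeff p j * y ^ j)" using p(3) by (simp add: poly_altdef m_def)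
    also have "\<dots> = (\<Sum>j<m. coeff p j * y ^ j) + y ^ m"
      using p(2) by (simp add: lessThan_Suc_atMost[symmetric] m_def)
    finally show ?thesis by (simp add: sum_negf add_eq_0_iff2 eq_commute[of 0])
  qed
  have "y * (y ^ j * v) \<in> int_mod.span V'" if "j < m" "v \<in> V" for j v
  proof (cases "Suc j < m")
    case True
    thus ?thesis using in_V'[OF True that(2)] by (simp add: int_mod.span_base mult.assoc[symmetric])
  next
    case False
    hence "y * (y ^ j * v) = y ^ m * v" using that(1) by (metis Suc_lessI mult.assoc power_Suc)
    also have "\<dots> = (\<Sum>i<m. y ^ i * (- coeff p i * v))"
      unfolding ym sum_distrib_right by (intro sum.cong) (auto simp: mult_ac)
    also have "\<dots> \<in> int_mod.span V'"
    proof (intro int_mod.span_sum span_pow)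
      fix i
      have "- coeff p i \<in> stab V"
        using p(1) by (intro csubring_uminus[OF csubring_stab]) (auto simp: coeffs_in_def)
      thus "- coeff p i * v \<in> int_mod.span V" using that(2) by (simp add: stab_def)
    qed auto
    finally show ?thesis .
  qed
  hence y: "y \<in> stab V'" by (auto simp: stab_def V'_def)
  show ?thesis
  proof (rule that[OF _ _ v0(2) sub y])
    show "finite V'" using fin by (simp add: V'_def)
    show "v0 \<in> V'" using in_V'[OF \<open>m > 0\<close> v0(1)] by simp
  qed
qed

lemma algebraic_int_stab:
  assumes "finite V" "v0 \<in> V" "v0 \<noteq> 0" "y \<in> stab V"
  shows "algebraic_int y"
  using algebraic_int_if_stable_span[OF assms(1-3)] assms(4) by (auto simp: stab_def)

text \<open>Starting from V = {1}, the numbers are adjoined one by one through their monic integral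
  equations.\<close>

lemma ex_stab_algebraic_ints:
  assumes "finite C" "\<And>c. c \<in> C \<Longrightarrow> algebraic_int c"
  shows "\<exists>V v0. finite V \<and> v0 \<in> V \<and> v0 \<noteq> 0 \<and> C \<subseteq> stab V"
  using assms
proof (induction C rule: finite_induct)
  case empty
  show ?case by (intro exI[of _ "{1}"] exI[of _ 1]) auto
next
  case (insert c C)
  then obtain V v0 where V: "finite V" "v0 \<in> V" "v0 \<noteq> 0" "C \<subseteq> stab V" by auto
  have "algebraic_int c" using insert.prems by simp
  then obtain p where p: "lead_coeff p = 1" "\<forall>i. coeff p i \<in> \<int>" "poly p c = 0"
    by (auto elim: algebraic_int.cases)
  have "coeffs_in (stab V) p" unfolding coeffs_in_def
    using p(2) csubring_of_int[OF csubring_stab] by (metis Ints_cases)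
  obtain V' v0' where "finite V'" "v0' \<in> V'" "v0' \<noteq> 0" "stab V \<subseteq> stab V'" "c \<in> stab V'"
    by (rule stab_extend[OF V(1-3) \<open>coeffs_in (stab V) p\<close> p(1,3)])
  thus ?case using V(4) by (intro exI[of _ V'] exI[of _ v0']) auto
qed

lemma csubring_algebraic_int: "csubring {x. algebraic_int x}"
proof -
  have "algebraic_int (x - y) \<and> algebraic_int (x * y)" if "algebraic_int x" "algebraic_int y" for x y :: complex
  proof -
    have "\<exists>V v0. finite V \<and> v0 \<in> V \<and> v0 \<noteq> 0 \<and> {x, y} \<subseteq> stab V"
      using that by (intro ex_stab_algebraic_ints, simp, blast)
    then obtain V v0 where V: "finite V" "v0 \<in> V" "v0 \<noteq> 0" "{x, y} \<subseteq> stab V" by blast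
    have "x - y \<in> stab V" "x * y \<in> stab V"
      using V(4) csubring_diff[OF csubring_stab] csubring_mult[OF csubring_stab] by blast+
    thus ?thesis using algebraic_int_stab[OF V(1-3)] by blast
  qed
  thus ?thesis unfolding csubring_def by simp
qed

text \<open>All coefficients lie in one multiplier ring, to which y is then adjoined. This is needed
  where an equation has algebraic integers, and not just integers, as coefficients.\<close>

lemma algebraic_int_integrally_closed:
  assumes "coeffs_in {x. algebraic_int x} p" "lead_coeff p = 1" "poly p y = 0"
  shows "algebraic_int (y :: complex)"
proof -
  have "\<exists>V v0. finite V \<and> v0 \<in> V \<and> v0 \<noteq> 0 \<and> coeff p ` {..degree p} \<subseteq> stab V"
    using assms(1) unfolding coeffs_in_def by (intro ex_stab_algebraic_ints, simp, blast)
  then obtain V v0 where V: "finite V" "v0 \<in> V" "v0 \<noteq> 0" "coeff p ` {..degree p} \<subseteq> stab V"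
    by blast
  have "coeff p i \<in> stab V" for i
  proof (cases "i \<le> degree p")
    case True
    thus ?thesis using V(4) by blast
  next
    case False
    hence "coeff p i = 0" by (intro coeff_eq_0) simp
    thus ?thesis using csubring_0[OF csubring_stab] by metis
  qed
  hence "coeffs_in (stab V) p" by (simp add: coeffs_in_def)
  obtain V' v0' where "finite V'" "v0' \<in> V'" "v0' \<noteq> 0" "stab V \<subseteq> stab V'" "y \<in> stab V'"
    by (rule stab_extend[OF V(1-3) \<open>coeffs_in (stab V) p\<close> assms(2,3)])
  thus ?thesis using algebraic_int_stab by blast
qed

text \<open>A substitute for Gauss's lemma. The root \<rho> need not be integral, but c \<rho> is,
  for c the leading coefficient of h; this allows the leading term of h to be removed and the degree
  to drop.\<close>

lemma coeffs_in_div_linear: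
  assumes g: "coeffs_in {x. algebraic_int x} ([:-\<rho>, 1:] * h)"
  shows "coeffs_in {x. algebraic_int x} h"
  using g
proof (induction "degree h" arbitrary: h rule: less_induct)
  case less
  note R = csubring_algebraic_int
  let ?O = "{x::complex. algebraic_int x}"
  show ?case
  proof (cases "h = 0")
    case True
    thus ?thesis using coeffs_in_0[OF R] by simp
  next
    case False
    define g where "g = [:-\<rho>, 1:] * h"
    define c where "c = lead_coeff h"
    define n where "n = degree h"
    have c0: "c \<noteq> 0" using False by (simp add: c_def)
    have deg: "degree g = Suc n" unfolding g_def n_def using False by (subst degree_mult_eq) auto
    have lc: "coeff g (Suc n) = c"
      using deg lead_coeff_mult[of "[:-\<rho>, 1:]" h] unfolding g_def[symmetric] by (simp add: c_def)
    have gO: "coeffs_in ?O g" using less.prems by (simp add: g_def)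
    have gi: "algebraic_int (coeff g i)" for i using gO by (simp add: coeffs_in_def)
    have cO: "algebraic_int c" using gi[of "Suc n"] lc by simp
    text \<open>\<open>c\<rho>\<close> is a root of the monic polynomial \<open>c\<^sup>n g(X/c)\<close>.\<close>
    define q where "q = monom 1 (Suc n) + (\<Sum>i\<le>n. monom (coeff g i * c ^ (n - i)) i)"
    have coeff_low: "coeff (\<Sum>i\<le>n. monom (coeff g i * c ^ (n - i)) i) (Suc n) = 0"
      by (simp add: coeff_sum)
    have "coeffs_in ?O q" unfolding q_def
    proof (intro coeffs_in_add[OF R] coeffs_in_sum[OF R] coeffs_in_monom[OF R])
      show "1 \<in> ?O" using csubring_1[OF R] .
      fix i
      have "c ^ (n - i) \<in> ?O" using csubring_power[OF R] cO by simp
      thus "coeff g i * c ^ (n - i) \<in> ?O" using csubring_mult[OF R] gi by simp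
    qed
    moreover have "lead_coeff q = 1"
    proof -
      have "degree (\<Sum>i\<le>n. monom (coeff g i * c ^ (n - i)) i) \<le> n"
        by (rule degree_sum_le) (auto intro: order.trans[OF degree_monom_le])
      hence "degree q = Suc n" unfolding q_def
        by (subst degree_add_eq_left) (auto simp: degree_monom_eq)
      thus ?thesis using coeff_low by (simp add: q_def)
    qed
    moreover have "poly q (c * \<rho>) = 0"
    proof -
      have "poly g \<rho> = 0" by (simp add: g_def)
      hence "0 = c ^ n * (\<Sum>i\<le>Suc n. coeff g i * \<rho> ^ i)"
        using deg by (simp add: poly_altdef)
      also have "\<dots> = (\<Sum>i\<le>n. c ^ n * (coeff g i * \<rho> ^ i)) + (c * \<rho>) ^ Suc n"
        using lc by (simp add: sum_distrib_left distrib_left power_mult_distrib)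
      also have "(\<Sum>i\<le>n. c ^ n * (coeff g i * \<rho> ^ i)) = (\<Sum>i\<le>n. coeff g i * c ^ (n - i) * (c * \<rho>) ^ i)"
      proof (rule sum.cong)
        fix i assume "i \<in> {..n}"
        hence "c ^ n = c ^ (n - i) * c ^ i" by (simp flip: power_add)
        thus "c ^ n * (coeff g i * \<rho> ^ i) = coeff g i * c ^ (n - i) * (c * \<rho>) ^ i"
          by (simp add: power_mult_distrib)
      qed auto
      finally show ?thesis unfolding q_def
        by (simp add: poly_sum poly_monom add.commute)
    qed
    ultimately have crO: "algebraic_int (c * \<rho>)" by (rule algebraic_int_integrally_closed)
    \<comment> \<open>Removing c X^n from h changes the product by c X^(n+1) - c \<rho> X^n, whose
      coefficients are algebraic integers.\<close>
    define h' where "h' = h - monom c n"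
    have eq: "[:-\<rho>, 1:] * h' = g - (monom c (Suc n) - monom (c * \<rho>) n)"
      unfolding h'_def g_def by (simp add: right_diff_distrib smult_monom monom_Suc mult.commute minus_monom)
    have h'O: "coeffs_in ?O ([:-\<rho>, 1:] * h')" unfolding eq
      using cO crO by (intro coeffs_in_diff[OF R] coeffs_in_monom[OF R] gO) auto
    have "coeffs_in ?O h'"
    proof (cases "h' = 0")
      case True
      thus ?thesis using coeffs_in_0[OF R] by simp
    next
      case False
      have "degree h' \<le> n" unfolding h'_def n_def
        by (intro degree_diff_le) (auto intro: degree_monom_le)
      moreover have "coeff h' n = 0" by (simp add: h'_def c_def n_def)
      ultimately have "degree h' < n"
        using False by (metis le_neq_implies_less leading_coeff_0_iff)
      thus ?thesis using less.hyps h'O by (simp add: n_def)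
    qed
    moreover have "h = h' + monom c n" by (simp add: h'_def)
    ultimately show ?thesis
      using coeffs_in_add[OF R] coeffs_in_monom[OF R] cO by (metis mem_Collect_eq)
  qed
qed

text \<open>The linear factors outside S are divided off one at a time; the value at 0 of what
  remains is, up to sign, the claimed product.\<close>

lemma algebraic_int_subset_prod:
  assumes fin: "finite I" and "coeffs_in {x. algebraic_int x} (smult c (\<Prod>i\<in>I. [:-\<rho> i, 1:]))"
    and S: "S \<subseteq> I"
  shows "algebraic_int (c * (\<Prod>i\<in>S. \<rho> i))"
proof -
  note R = csubring_algebraic_int
  have *: "coeffs_in {x. algebraic_int x} (smult c (\<Prod>i\<in>S. [:-\<rho> i, 1:]))"
    if "finite J" "coeffs_in {x. algebraic_int x} (smult c (\<Prod>i\<in>S \<union> J. [:-\<rho> i, 1:]))"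
       "S \<inter> J = {}" "finite S" for J
    using that
  proof (induction J rule: finite_induct)
    case (insert j J)
    have "(\<Prod>i\<in>S \<union> insert j J. [:-\<rho> i, 1:]) = [:-\<rho> j, 1:] * (\<Prod>i\<in>S \<union> J. [:-\<rho> i, 1:])"
      using insert by simp
    hence "coeffs_in {x. algebraic_int x} ([:-\<rho> j, 1:] * smult c (\<Prod>i\<in>S \<union> J. [:-\<rho> i, 1:]))"
      using insert.prems(1) by (simp only: mult_smult_right)
    hence "coeffs_in {x. algebraic_int x} (smult c (\<Prod>i\<in>S \<union> J. [:-\<rho> i, 1:]))"
      by (rule coeffs_in_div_linear)
    thus ?case using insert by auto
  qed simp
  have "coeffs_in {x. algebraic_int x} (smult c (\<Prod>i\<in>S. [:-\<rho> i, 1:]))"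
    using assms by (intro *[of "I - S"]) (auto simp: Un_absorb1 finite_subset)
  hence "poly (smult c (\<Prod>i\<in>S. [:-\<rho> i, 1:])) 0 \<in> {x. algebraic_int x}"
    using csubring_0[OF R] by (rule poly_in[OF R])
  moreover have "poly (smult c (\<Prod>i\<in>S. [:-\<rho> i, 1:])) 0 = (-1) ^ card S * (c * (\<Prod>i\<in>S. \<rho> i))"
    by (simp add: poly_prod prod_uminus)
  ultimately have "(-1) ^ card S * (c * (\<Prod>i\<in>S. \<rho> i)) \<in> {x. algebraic_int x}" by (simp only:)
  hence "(-1) ^ card S * ((-1) ^ card S * (c * (\<Prod>i\<in>S. \<rho> i))) \<in> {x. algebraic_int x}"
    by (rule csubring_mult[OF R csubring_power[OF R csubring_uminus[OF R csubring_1[OF R]]]])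
  moreover have "(-1::complex) ^ card S * (-1) ^ card S = 1" by (simp flip: power_mult_distrib)
  ultimately show ?thesis by (simp add: mult.assoc[symmetric])
qed

text \<open>The product splits into T layers, layer s collecting the indices with s <
  \<open>e i\<close>. Each layer is a product over a subset and needs a single c, so c^T suffices
  however many indices there are; this is what later produces the T-th power of a Mahler
  measure.\<close>

lemma algebraic_int_prod_powers:
  assumes fin: "finite I" and "coeffs_in {x. algebraic_int x} (smult c (\<Prod>i\<in>I. [:-\<rho> i, 1:]))"
    and e: "\<And>i. i \<in> I \<Longrightarrow> e i \<le> T"
  shows "algebraic_int (c ^ T * (\<Prod>i\<in>I. \<rho> i ^ e i))"
proof -
  have "\<rho> i ^ e i = (\<Prod>s<T. if s < e i then \<rho> i else 1)" if "i \<in> I" for i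
  proof -
    have "{..<T} \<inter> {s. s < e i} = {..<e i}" using e[OF that] by auto
    thus ?thesis by (simp add: prod.If_cases)
  qed
  hence "(\<Prod>i\<in>I. \<rho> i ^ e i) = (\<Prod>i\<in>I. \<Prod>s<T. if s < e i then \<rho> i else 1)"
    by (intro prod.cong) auto
  also have "\<dots> = (\<Prod>s<T. \<Prod>i\<in>I. if s < e i then \<rho> i else 1)" by (rule prod.swap)
  also have "\<dots> = (\<Prod>s<T. \<Prod>i\<in>{i\<in>I. s < e i}. \<rho> i)"
    using fin by (intro prod.cong[OF refl]) (rule prod.inter_filter[symmetric])
  finally have "c ^ T * (\<Prod>i\<in>I. \<rho> i ^ e i) = (\<Prod>s<T. c * (\<Prod>i\<in>{i\<in>I. s < e i}. \<rho> i))"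
    by (simp add: prod.distrib)
  also have "\<dots> \<in> {x. algebraic_int x}"
    using algebraic_int_subset_prod[OF fin assms(2)]
    by (intro csubring_prod[OF csubring_algebraic_int]) simp
  finally show ?thesis by simp
qed

section \<open>Products over the roots of a polynomial\<close>

lemma complex_factorization:
  fixes p :: "complex poly"
  obtains \<rho> where "p = smult (lead_coeff p) (\<Prod>i<degree p. [:-\<rho> i, 1:])"
proof -
  obtain as where as: "smult (lead_coeff p) (\<Prod>a\<leftarrow>as. [:-a, 1:]) = p" "length as = degree p"
    using fundamental_theorem_algebra_factorized by blast
  have "(\<Prod>a\<leftarrow>as. [:-a, 1:]) = (\<Prod>i<degree p. [:-(as ! i), 1:])"
    unfolding as(2)[symmetric] by (simp add: prod.list_conv_set_nth atLeast0LessThan)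
  thus ?thesis using as(1) that[of "\<lambda>i. as ! i"] by simp
qed

text \<open>The Euclidean algorithm for the resultant, used in place of symmetric polynomials: g may
  be replaced by its remainder r modulo f, and exchanging the roles of f and r costs only a sign and
  a power of the leading coefficient of r.\<close>

lemma prod_over_roots_in_subfield:
  assumes F: "csubfield F"
  assumes "coeffs_in F (\<Prod>i<(n::nat). [:-\<rho> i, 1:])" "coeffs_in F g"
  shows "(\<Prod>i<(n::nat). poly g (\<rho> i)) \<in> F"
  using assms(2,3)
proof (induction n arbitrary: \<rho> g rule: less_induct)
  case (less n)
  have R: "csubring F" using F by (simp add: csubfield_def)
  define f where "f = (\<Prod>i<n. [:-\<rho> i, 1:])"
  have lcf: "lead_coeff f = 1" unfolding f_def by (simp add: lead_coeff_prod)
  have degf: "degree f = n" unfolding f_def by (subst degree_prod_sum_eq) auto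
  have rootf: "poly f (\<rho> i) = 0" if "i < n" for i using that by (auto simp: f_def poly_prod)
  have fF: "coeffs_in F f" using less.prems by (simp add: f_def)
  obtain q r where qr: "coeffs_in F q" "coeffs_in F r" "g = q * f + r" "r = 0 \<or> degree r < degree f"
    using coeffs_in_division[OF R fF lcf less.prems(2)] by blast
  have gr: "(\<Prod>i<n. poly g (\<rho> i)) = (\<Prod>i<n. poly r (\<rho> i))"
    using rootf by (intro prod.cong) (auto simp: qr(3))
  show ?case
  proof (cases "r = 0")
    case True
    show ?thesis unfolding gr True using csubring_0[OF R] csubring_1[OF R]
      by (intro csubring_prod[OF R]) simp
  next
    case False
    define m where "m = degree r"
    have mn: "m < n" using qr(4) False degf by (simp add: m_def)
    define c where "c = lead_coeff r"
    have cF: "c \<in> F" using qr(2) by (simp add: c_def coeffs_in_def)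
    have c0: "c \<noteq> 0" using False by (simp add: c_def)
    obtain \<sigma> where \<sigma>: "r = smult c (\<Prod>j<m. [:-\<sigma> j, 1:])"
      using complex_factorization[of r] unfolding m_def c_def by blast
    have "(\<Prod>j<m. [:-\<sigma> j, 1:]) = smult (inverse c) r"
      using c0 by (subst \<sigma>) simp
    moreover have "inverse c \<in> F" using F cF by (simp add: csubfield_def)
    ultimately have "coeffs_in F (\<Prod>j<m. [:-\<sigma> j, 1:])" using coeffs_in_smult[OF R] qr(2) by simp
    hence IH: "(\<Prod>j<m. poly f (\<sigma> j)) \<in> F" using less.IH[OF mn] fF by blast
    \<comment> \<open>Reciprocity: up to these factors, the products of r over the roots of f and of
      f over the roots of r are both the double product of all differences of roots.\<close>
    have neg: "(\<Prod>i<n. \<rho> i - \<sigma> j) = (-1) ^ n * poly f (\<sigma> j)" for j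
      using prod_uminus[of "\<lambda>i. \<sigma> j - \<rho> i" "{..<n}"] by (simp add: f_def poly_prod)
    have "(\<Prod>i<n. poly r (\<rho> i)) = (\<Prod>i<n. c * (\<Prod>j<m. \<rho> i - \<sigma> j))"
      by (subst \<sigma>) (simp add: poly_prod)
    also have "\<dots> = c ^ n * (\<Prod>i<n. \<Prod>j<m. \<rho> i - \<sigma> j)"
      by (simp add: prod.distrib)
    also have "(\<Prod>i<n. \<Prod>j<m. \<rho> i - \<sigma> j) = (\<Prod>j<m. \<Prod>i<n. \<rho> i - \<sigma> j)"
      by (rule prod.swap)
    also have "\<dots> = (\<Prod>j<m. (-1) ^ n * poly f (\<sigma> j))" unfolding neg ..
    also have "\<dots> = ((-1) ^ n) ^ m * (\<Prod>j<m. poly f (\<sigma> j))" by (simp add: prod.distrib)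
    finally show ?thesis unfolding gr
      by (auto intro!: csubring_mult[OF R] csubring_power[OF R] csubring_uminus[OF R] csubring_1[OF R] cF IH)
  qed
qed

section \<open>Conjugates and heights\<close>

text \<open>Division by X - k, with k the start of the range, leaves a quotient whose values are
  known from k + 1 on, where no denominator is 0. It turns the result on norms into one on
  characteristic polynomials, whose value at k is the norm of k - g.\<close>

lemma coeffs_in_if_values_in:
  assumes F: "csubfield F" and "\<And>n::nat. n \<ge> k \<Longrightarrow> poly p (of_nat n) \<in> F"
  shows "coeffs_in F p"
  using assms(2)
proof (induction "degree p" arbitrary: p k)
  case 0
  then obtain c where p: "p = [:c:]" by (metis degree_eq_zeroE)
  have "c \<in> F" using 0(2)[of k] by (simp add: p)
  thus ?case using F coeffs_in_const by (simp add: p csubfield_def)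
next
  case (Suc d)
  have R: "csubring F" using F by (simp add: csubfield_def)
  define a :: complex where "a = of_nat k"
  define q where "q = synthetic_div p a"
  have p: "p = [:-a, 1:] * q + [:poly p a:]" unfolding q_def by (rule synthetic_div_correct'[symmetric])
  have pa: "poly p a \<in> F" using Suc.prems[of k] by (simp add: a_def)
  have "poly q (of_nat n) \<in> F" if n: "n \<ge> Suc k" for n
  proof -
    have ne: "of_nat n - a \<noteq> 0" using n by (simp add: a_def)
    have "poly p (of_nat n) = (of_nat n - a) * poly q (of_nat n) + poly p a"
      by (subst p) (simp add: algebra_simps)
    hence eq: "poly q (of_nat n) = (poly p (of_nat n) - poly p a) * inverse (of_nat n - a)"
      using ne by (simp add: field_simps)
    have "(of_int (int n) :: complex) - of_int (int k) \<in> F"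
      by (intro csubring_diff[OF R] csubring_of_int[OF R])
    hence "inverse (of_nat n - a) \<in> F" using F by (simp add: csubfield_def a_def)
    moreover have "poly p (of_nat n) \<in> F" using Suc.prems[of n] n by simp
    ultimately show ?thesis unfolding eq using pa by (intro csubring_mult[OF R] csubring_diff[OF R])
  qed
  moreover have "d = degree q" using Suc.hyps(2) by (simp add: q_def degree_synthetic_div)
  ultimately have "coeffs_in F q" using Suc.hyps(1)[of q "Suc k"] by blast
  moreover have "- a \<in> F"
    using csubring_uminus[OF R csubring_of_int[OF R, of "int k"]] by (simp add: a_def)
  ultimately show ?case
    by (subst p) (intro coeffs_in_add[OF R] coeffs_in_mult[OF R] coeffs_in_pCons[OF R]
      coeffs_in_const[OF R] coeffs_in_0[OF R] csubring_1[OF R] pa)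
qed

lemma coeffs_in_char_poly:
  assumes F: "csubfield F"
    and "coeffs_in F (\<Prod>i<(n::nat). [:-\<rho> i, 1:])" "coeffs_in F g"
  shows "coeffs_in F (\<Prod>i<n. [:- poly g (\<rho> i), 1:])"
proof (rule coeffs_in_if_values_in[OF F])
  fix k :: nat
  have R: "csubring F" using F by (simp add: csubfield_def)
  have "of_nat k \<in> F" using csubring_of_int[OF R, of "int k"] by simp
  hence "(\<Prod>i<n. poly ([:of_nat k:] - g) (\<rho> i)) \<in> F"
    using assms coeffs_in_diff[OF R] coeffs_in_const[OF R] by (intro prod_over_roots_in_subfield) auto
  thus "poly (\<Prod>i<n. [:- poly g (\<rho> i), 1:]) (of_nat k) \<in> F" by (simp add: poly_prod)
qed

text \<open>By conjugacy m is the minimal polynomial of every root of p, so it can be split off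
  until a constant remains, which is 1 because everything is monic.\<close>

lemma power_of_min_poly:
  assumes m: "is_min_poly m x"
    and p: "coeffs_in \<rat> p" "lead_coeff p = 1" "\<And>y. poly p y = 0 \<Longrightarrow> poly m y = 0"
  shows "\<exists>k. p = m ^ k"
  using p
proof (induction "degree p" arbitrary: p rule: less_induct)
  case less
  note D = is_min_polyD[OF m]
  show ?case
  proof (cases "degree p = 0")
    case True
    then obtain c where "p = [:c:]" by (metis degree_eq_zeroE)
    hence "p = m ^ 0" using less.prems(2) by simp
    thus ?thesis by blast
  next
    case False
    have "\<not> constant (poly p)" using False by (simp add: constant_degree)
    then obtain y where y: "poly p y = 0" using fundamental_theorem_of_algebra by blast
    have my: "is_min_poly m y" using is_min_poly_conjugate[OF m] less.prems(3)[OF y] .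
    hence "m dvd p" using less.prems(1) y is_min_polyD(5) by blast
    then obtain q where q: "coeffs_in \<rat> q" "p = q * m"
      using coeffs_in_dvd[OF csubring_Rats D(1,2) less.prems(1)] by blast
    have lcq: "lead_coeff q = 1" using less.prems(2) D(2) lead_coeff_mult[of q m] unfolding q(2) by simp
    have "degree m \<noteq> 0"
    proof
      assume "degree m = 0"
      then obtain c where "m = [:c:]" by (metis degree_eq_zeroE)
      thus False using D(2,3) by simp
    qed
    moreover have "q \<noteq> 0" using lcq by auto
    ultimately have "degree q < degree p" using D(4) degree_mult_eq[of q m] unfolding q(2) by simp
    moreover have "poly m y = 0" if "poly q y = 0" for y
      using less.prems(3)[of y] that by (simp add: q(2))
    ultimately obtain k where "q = m ^ k" using less.hyps[of q] q(1) lcq by blast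
    hence "p = m ^ Suc k" by (simp add: q(2))
    thus ?thesis by blast
  qed
qed

lemma ex_common_denominator:
  assumes "coeffs_in \<rat> p"
  shows "\<exists>d Q. d \<noteq> 0 \<and> smult (of_int d) p = map_poly of_int Q"
  using assms
proof (induction p)
  case 0
  show ?case by (intro exI[of _ 1] exI[of _ 0]) simp
next
  case (pCons a p)
  have "coeff (pCons a p) 0 \<in> \<rat>" using pCons.prems unfolding coeffs_in_def by blast
  hence "a \<in> \<rat>" by simp
  then obtain u v :: int where uv: "v \<noteq> 0" "a = of_int u / of_int v"
    by (metis Rats_cases' less_irrefl)
  have "coeffs_in \<rat> p" unfolding coeffs_in_def
    using pCons.prems unfolding coeffs_in_def by (metis coeff_pCons_Suc)
  then obtain d Q where dQ: "d \<noteq> 0" "smult (of_int d) p = map_poly of_int Q" using pCons.IH by blast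
  have "smult (of_int (v * d)) (pCons a p) = pCons (of_int (u * d)) (smult (of_int v) (smult (of_int d) p))"
    using uv by simp
  also have "\<dots> = map_poly of_int (pCons (u * d) (smult v Q))"
    unfolding dQ(2) by (simp add: hom_distribs)
  finally show ?case using uv(1) dQ(1) by (intro exI[of _ "v * d"]) auto
qed

section \<open>Integer minimal polynomials, Mahler measure and height\<close>

lemma int_min_poly_props:
  assumes "algebraic x"
  shows "Factorial_Ring.irreducible (int_min_poly x)" "lead_coeff (int_min_poly x) > 0"
    "poly (map_poly of_int (int_min_poly x)) x = 0"
  using theI'[OF int_min_poly_ex1[OF assms]] unfolding int_min_poly_def by blast+

text \<open>Coprimality over Z gives gcd 1 over Q by Gauss's lemma, and a Bezout identity excludes a
  common complex root.\<close>

lemma int_min_poly_dvd: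
  assumes "algebraic x" and q: "poly (map_poly of_int q) x = 0"
  shows "int_min_poly x dvd q"
proof (rule ccontr)
  let ?p = "int_min_poly x"
  note p = int_min_poly_props[OF assms(1)]
  assume "\<not> ?p dvd q"
  hence cop: "Rings.coprime ?p q"
    using p(1) by (intro prime_elem_imp_coprime irreducible_imp_prime_elem_gcd)
  interpret rh: map_poly_comm_ring_hom "of_rat :: rat \<Rightarrow> complex"
    by unfold_locales (auto simp: of_rat_add of_rat_mult)
  let ?h = "of_int_poly :: int poly \<Rightarrow> rat poly"
  have "gcd (?h ?p) (?h q) = 1"
    unfolding gcd_rat_to_gcd_int using cop by (simp add: coprime_iff_gcd_eq_1)
  then obtain u v where "u * ?h ?p + v * ?h q = 1" by (metis bezout_coefficients_fst_snd)
  hence "map_poly of_rat (u * ?h ?p + v * ?h q) = (1 :: complex poly)" by simp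
  moreover have e: "map_poly of_rat (?h y) = (of_int_poly y :: complex poly)" for y
    by (rule poly_eqI) (simp add: coeff_map_poly)
  ultimately have "poly (map_poly of_rat u * of_int_poly ?p + map_poly of_rat v * of_int_poly q) x = (1::complex)"
    by (simp add: rh.hom_add rh.hom_mult)
  thus False using p(3) q by simp
qed

text \<open>Heights are defined by the primitive integer polynomial, the algebra above works with
  the monic rational one. Clearing the denominators of m bounds the degree from above, divisibility
  by m bounds it from below, so the two differ by a constant.\<close>

lemma int_min_poly_eq_smult:
  assumes m: "is_min_poly m x" and x: "algebraic x"
  shows "map_poly of_int (int_min_poly x) = smult (of_int (lead_coeff (int_min_poly x))) m"
    and "alg_degree x = degree m"
proof -
  note D = is_min_polyD[OF m] and p = int_min_poly_props[OF x]
  let ?P = "map_poly of_int (int_min_poly x) :: complex poly"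
  obtain d Q where dQ: "d \<noteq> 0" "smult (of_int d) m = map_poly of_int Q"
    using ex_common_denominator[OF D(1)] by blast
  have "poly (map_poly of_int Q) x = 0" unfolding dQ(2)[symmetric] using D(3) by simp
  hence "int_min_poly x dvd Q" by (rule int_min_poly_dvd[OF x])
  moreover have degQ: "degree Q = degree m"
  proof -
    have "degree (smult (complex_of_int d) m) = degree (of_int_poly Q :: complex poly)"
      by (simp only: dQ(2))
    thus ?thesis using dQ(1) by simp
  qed
  moreover have "Q \<noteq> 0" using dQ D(4) by auto
  ultimately have le: "degree ?P \<le> degree m" using dvd_imp_degree_le[of "int_min_poly x" Q] by simp
  have "coeffs_in \<rat> ?P" by (simp add: coeffs_in_def)
  hence "m dvd ?P" using D(5) p(3) by blast
  then obtain q where q: "?P = m * q" by (elim dvdE)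
  have "?P \<noteq> 0" using p(2) by auto
  hence "m \<noteq> 0" "q \<noteq> 0" using q by auto
  hence "degree ?P = degree m + degree q" unfolding q by (rule degree_mult_eq)
  hence degs: "degree q = 0" "degree ?P = degree m" using le by auto
  then obtain c where c: "q = [:c:]" by (metis degree_eq_zeroE)
  have "lead_coeff ?P = c" using D(2) unfolding q c by (simp add: lead_coeff_mult)
  hence "c = of_int (lead_coeff (int_min_poly x))" by simp
  thus "?P = smult (of_int (lead_coeff (int_min_poly x))) m" using q c by simp
  show "alg_degree x = degree m" using degs(2) by (simp add: alg_degree_def)
qed

lemma mahler_measure_alg_ge_1:
  assumes "algebraic x"
  shows "mahler_measure_alg x \<ge> 1"
proof -
  have "1 \<le> cmod (lead_coeff (map_poly of_int (int_min_poly x)))"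
    using int_min_poly_props(2)[OF assms] by simp
  thus ?thesis
    unfolding mahler_measure_alg_def mahler_measure_def mahler_measure_poly_via_monic
    using mult_mono[OF _ mahler_measure_monic_ge_1] by fastforce
qed

lemma abs_log_height_nonneg: "algebraic x \<Longrightarrow> abs_log_height x \<ge> 0"
  using mahler_measure_alg_ge_1 by (simp add: abs_log_height_def)

lemma mahler_measure_power: "mahler_measure_poly (p ^ k) = mahler_measure_poly p ^ k"
  using mahler_measure_constant[of 1] by (induction k) (simp_all add: measure_eq_prod)

text \<open>The family lists the roots of m, each k times, as the embeddings of a larger field do
  with x. The right denominator is a^k, with a the leading coefficient over Z: it makes the product
  the k-th power of the integer minimal polynomial, of Mahler measure M(x)^k = exp(n h(x)), since n
  = k d(x).\<close>

lemma conjugate_family_height: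
  assumes x: "algebraic x" and m: "is_min_poly m x"
    and k: "(\<Prod>i<n. [:- y i, 1:]) = m ^ k"
  obtains c :: int where "c \<noteq> 0"
    "coeffs_in {x. algebraic_int x} (smult (of_int c) (\<Prod>i<(n::nat). [:- y i, 1:]))"
    "\<bar>real_of_int c\<bar> * (\<Prod>i<n. max 1 (cmod (y i))) = exp (real n * abs_log_height x)"
proof -
  let ?P = "map_poly of_int (int_min_poly x) :: complex poly"
  define a where "a = lead_coeff (int_min_poly x)"
  have a: "a > 0" using int_min_poly_props(2)[OF x] by (simp add: a_def)
  have P: "?P = smult (of_int a) m" using int_min_poly_eq_smult[OF m x] by (simp add: a_def)
  have Pk: "smult (of_int (a ^ k)) (\<Prod>i<n. [:- y i, 1:]) = ?P ^ k"
    unfolding k P by (simp add: smult_power)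
  have n: "n = k * degree m"
  proof -
    have "degree (\<Prod>i<n. [:- y i, 1:]) = n" by (subst degree_prod_sum_eq) auto
    thus ?thesis unfolding k by (simp add: degree_power_eq is_min_polyD(4)[OF m] mult.commute)
  qed
  have d0: "degree m > 0"
  proof (rule ccontr)
    assume "\<not> degree m > 0"
    then obtain c where "m = [:c:]" by (metis degree_eq_zeroE neq0_conv)
    thus False using is_min_polyD(2,3)[OF m] by simp
  qed
  show ?thesis
  proof
    show "a ^ k \<noteq> 0" using a by simp
    show "coeffs_in {x. algebraic_int x} (smult (of_int (a ^ k)) (\<Prod>i<n. [:- y i, 1:]))"
      unfolding Pk
    proof (intro coeffs_in_power[OF csubring_algebraic_int])
      show "coeffs_in {x. algebraic_int x} ?P"
        using csubring_of_int[OF csubring_algebraic_int] by (simp add: coeffs_in_def)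
    qed
    have "real_of_int (a ^ k) * (\<Prod>i<n. max 1 (cmod (y i)))
        = mahler_measure_poly (smult (of_int (a ^ k)) (\<Prod>i\<leftarrow>map y [0..<n]. [:- i, 1:]))"
      unfolding mahler_measure_poly_explicit using a
      by (simp add: prod.list_conv_set_nth atLeast0LessThan norm_power)
    also have "smult (of_int (a ^ k)) (\<Prod>i\<leftarrow>map y [0..<n]. [:- i, 1:]) = ?P ^ k"
      unfolding Pk[symmetric] by (simp add: prod.list_conv_set_nth atLeast0LessThan)
    also have "mahler_measure_poly (?P ^ k) = mahler_measure_alg x ^ k"
      by (simp add: mahler_measure_power mahler_measure_alg_def mahler_measure_def)
    also have "\<dots> = exp (real k * ln (mahler_measure_alg x))"
      using mahler_measure_alg_ge_1[OF x] by (simp add: exp_of_nat_mult)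
    also have "real k * ln (mahler_measure_alg x) = real n * abs_log_height x"
      using d0 int_min_poly_eq_smult(2)[OF m x] by (simp add: abs_log_height_def n)
    finally show "\<bar>real_of_int (a ^ k)\<bar> * (\<Prod>i<n. max 1 (cmod (y i))) = exp (real n * abs_log_height x)"
      using a by simp
  qed
qed

section \<open>Liouville's inequality\<close>

text \<open>The denominators c and d are those of \<open>conjugate_family_height\<close>, so that in
  the final estimate each combines with the product of the max(1, |conjugate|) to an exponential of
  n times a height, exactly to the power T.\<close>

lemma liouville_primitive:
  fixes p :: "nat \<Rightarrow> nat \<Rightarrow> int" and H :: real
  assumes m: "is_min_poly m \<theta>" and n: "n = degree m"
    and A: "coeffs_in \<rat> A" "poly A \<theta> = \<alpha>" and B: "coeffs_in \<rat> B" "poly B \<theta> = \<beta>"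
    and alg: "algebraic \<alpha>" "algebraic \<beta>"
    and T: "T \<ge> 1" and H: "H \<ge> 1" and pH: "\<And>k l. k < T \<Longrightarrow> l < T \<Longrightarrow> \<bar>real_of_int (p k l)\<bar> \<le> H"
    and x: "x = (\<Sum>k<T. \<Sum>l<T. of_int (p k l) * \<alpha> ^ k * \<beta> ^ l)" and x0: "x \<noteq> 0"
  shows "1 \<le> cmod x * (real T ^ 2 * H) ^ n * exp (real n * abs_log_height \<alpha>) ^ T
           * exp (real n * abs_log_height \<beta>) ^ T"
proof -
  note D = is_min_polyD[OF m] and R = csubring_Rats and O = csubring_algebraic_int
  obtain \<rho> where "m = smult (lead_coeff m) (\<Prod>i<degree m. [:-\<rho> i, 1:])"
    using complex_factorization[of m] by blast
  hence \<rho>: "m = (\<Prod>i<n. [:-\<rho> i, 1:])" using D(2) n by simp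
  have root: "poly m (\<rho> i) = 0" if "i < n" for i
    unfolding \<rho> poly_prod using that by (intro prod_zero) auto
  have vanish: "poly q (\<rho> i) = 0 \<longleftrightarrow> poly q \<theta> = 0" if "coeffs_in \<rat> q" "i < n" for q i
  proof
    have mi: "is_min_poly m (\<rho> i)" using is_min_poly_conjugate[OF m root[OF that(2)]] .
    assume "poly q (\<rho> i) = 0"
    hence "m dvd q" using is_min_polyD(5)[OF mi] that(1) by blast
    thus "poly q \<theta> = 0" using D(3) by auto
  next
    assume "poly q \<theta> = 0"
    hence "m dvd q" using D(5) that(1) by blast
    thus "poly q (\<rho> i) = 0" using root[OF that(2)] by auto
  qed
  \<comment> \<open>The images of y under the n embeddings of Q(\<theta>) are the C(\<rho> i). The
    polynomial with these roots is rational and its roots are conjugates of y, so it is a power of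
    the minimal polynomial of y.\<close>
  have family: "\<exists>c::int. c \<noteq> 0 \<and>
      coeffs_in {x. algebraic_int x} (smult (of_int c) (\<Prod>i<n. [:- poly C (\<rho> i), 1:])) \<and>
      \<bar>real_of_int c\<bar> * (\<Prod>i<n. max 1 (cmod (poly C (\<rho> i)))) = exp (real n * abs_log_height y)"
    if C: "coeffs_in \<rat> C" "poly C \<theta> = y" "algebraic y" for C y
  proof -
    obtain my where my: "is_min_poly my y" using ex_min_poly[OF C(3)] by blast
    have "\<exists>k. (\<Prod>i<n. [:- poly C (\<rho> i), 1:]) = my ^ k"
    proof (rule power_of_min_poly[OF my])
      show "coeffs_in \<rat> (\<Prod>i<n. [:- poly C (\<rho> i), 1:])"
        using coeffs_in_char_poly[OF csubfield_Rats] D(1) C(1) unfolding \<rho> by blast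
      show "lead_coeff (\<Prod>i<n. [:- poly C (\<rho> i), 1:]) = 1" by (simp add: lead_coeff_prod)
      fix z assume "poly (\<Prod>i<n. [:- poly C (\<rho> i), 1:]) z = 0"
      then obtain i where i: "i < n" "z = poly C (\<rho> i)" by (auto simp: poly_prod)
      have "poly (pcompose my C) (\<rho> i) = 0"
        using is_min_polyD(3)[OF my] C(2)
        by (subst vanish) (auto simp: poly_pcompose i(1) intro!: coeffs_in_pcompose[OF R] is_min_polyD(1)[OF my] C(1))
      thus "poly my z = 0" by (simp add: poly_pcompose i(2))
    qed
    then obtain k where "(\<Prod>i<n. [:- poly C (\<rho> i), 1:]) = my ^ k" by blast
    from conjugate_family_height[OF C(3) my this] show ?thesis by metis
  qed
  define a where "a = (\<lambda>i. poly A (\<rho> i))"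
  define b where "b = (\<lambda>i. poly B (\<rho> i))"
  obtain c where c: "c \<noteq> 0"
      "coeffs_in {x. algebraic_int x} (smult (of_int c) (\<Prod>i<n. [:- a i, 1:]))"
      "\<bar>real_of_int c\<bar> * (\<Prod>i<n. max 1 (cmod (a i))) = exp (real n * abs_log_height \<alpha>)"
    using family[OF A alg(1)] unfolding a_def by blast
  obtain d where d: "d \<noteq> 0"
      "coeffs_in {x. algebraic_int x} (smult (of_int d) (\<Prod>i<n. [:- b i, 1:]))"
      "\<bar>real_of_int d\<bar> * (\<Prod>i<n. max 1 (cmod (b i))) = exp (real n * abs_log_height \<beta>)"
    using family[OF B alg(2)] unfolding b_def by blast
  \<comment> \<open>x = G(\<theta>), so the product of the values of G at the conjugates of \<theta>
    is the norm of x from Q(\<theta>).\<close>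
  define G where "G = (\<Sum>k<T. \<Sum>l<T. smult (of_int (p k l)) (A ^ k * B ^ l))"
  have GQ: "coeffs_in \<rat> G" unfolding G_def
    by (intro coeffs_in_sum[OF R] coeffs_in_smult[OF R] coeffs_in_mult[OF R] coeffs_in_power[OF R] A B) auto
  have polyG: "poly G y = (\<Sum>k<T. \<Sum>l<T. of_int (p k l) * poly A y ^ k * poly B y ^ l)" for y
    by (simp add: G_def poly_sum mult.assoc)
  have G\<theta>: "poly G \<theta> = x" unfolding polyG x A(2) B(2) ..
  define z where "z = (\<lambda>i. poly G (\<rho> i))"
  have z_eq: "z i = (\<Sum>(k,l)\<in>{..<T} \<times> {..<T}. of_int (p k l) * a i ^ k * b i ^ l)" for i
    unfolding z_def polyG a_def b_def by (simp add: sum.cartesian_product)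
  define N where "N = (\<Prod>i<n. z i)"
  have NQ: "N \<in> \<rat>" unfolding N_def z_def
    using prod_over_roots_in_subfield[OF csubfield_Rats _ GQ] D(1) unfolding \<rho> by blast
  have N0: "N \<noteq> 0" unfolding N_def z_def using vanish[OF GQ] G\<theta> x0 by simp
  have int: "algebraic_int (of_int c ^ T * of_int d ^ T * N)"
  proof -
    define g where "g = (\<lambda>i (k,l). of_int (p k l) * a i ^ k * b i ^ l)"
    define S where "S = {..<T} \<times> {..<T}"
    \<comment> \<open>Multiplying out, \<phi> picks one monomial for each conjugate. All exponents
      stay at most T, so the same factor c^T d^T clears every term.\<close>
    have "N = (\<Sum>\<phi>\<in>PiE {..<n} (\<lambda>_. S). \<Prod>i<n. g i (\<phi> i))"
      unfolding N_def z_eq g_def S_def by (rule prod_sum_PiE) auto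
    hence "of_int c ^ T * of_int d ^ T * N =
        (\<Sum>\<phi>\<in>PiE {..<n} (\<lambda>_. S). of_int c ^ T * of_int d ^ T * (\<Prod>i<n. g i (\<phi> i)))"
      by (simp add: sum_distrib_left)
    also have "\<dots> \<in> {x. algebraic_int x}"
    proof (rule csubring_sum[OF O])
      fix \<phi> assume \<phi>: "\<phi> \<in> PiE {..<n} (\<lambda>_. S)"
      have \<phi>T: "fst (\<phi> i) \<le> T" "snd (\<phi> i) \<le> T" if "i \<in> {..<n}" for i
        using PiE_mem[OF \<phi> that] by (auto simp: S_def)
      have "of_int c ^ T * of_int d ^ T * (\<Prod>i<n. g i (\<phi> i)) =
         (\<Prod>i<n. of_int (p (fst (\<phi> i)) (snd (\<phi> i)))) *
         ((of_int c ^ T * (\<Prod>i<n. a i ^ fst (\<phi> i))) * (of_int d ^ T * (\<Prod>i<n. b i ^ snd (\<phi> i))))"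
        by (simp add: g_def case_prod_unfold prod.distrib mult_ac)
      also have "\<dots> \<in> {x. algebraic_int x}"
      proof (rule csubring_mult[OF O csubring_prod[OF O csubring_of_int[OF O]] csubring_mult[OF O]])
        show "of_int c ^ T * (\<Prod>i<n. a i ^ fst (\<phi> i)) \<in> {x. algebraic_int x}"
          unfolding mem_Collect_eq by (rule algebraic_int_prod_powers[OF finite_lessThan c(2) \<phi>T(1)])
        show "of_int d ^ T * (\<Prod>i<n. b i ^ snd (\<phi> i)) \<in> {x. algebraic_int x}"
          unfolding mem_Collect_eq by (rule algebraic_int_prod_powers[OF finite_lessThan d(2) \<phi>T(2)])
      qed
      finally show "of_int c ^ T * of_int d ^ T * (\<Prod>i<n. g i (\<phi> i)) \<in> {x. algebraic_int x}" .
    qed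
    finally show ?thesis by simp
  qed
  have "of_int c ^ T * of_int d ^ T * N \<in> \<int>"
    by (rule rational_algebraic_int_is_int[OF int]) (use NQ in auto)
  moreover have "of_int c ^ T * of_int d ^ T * N \<noteq> 0" using c(1) d(1) N0 by simp
  ultimately have ge1: "1 \<le> cmod (of_int c ^ T * of_int d ^ T * N)"
  proof (elim Ints_cases)
    fix y assume y: "of_int c ^ T * of_int d ^ T * N = of_int y" "of_int c ^ T * of_int d ^ T * N \<noteq> 0"
    hence "y \<noteq> 0" by auto
    hence "1 \<le> \<bar>real_of_int y\<bar>" by linarith
    thus ?thesis unfolding y(1) by simp
  qed
  define w where "w = (\<lambda>i. real T ^ 2 * H * max 1 (cmod (a i)) ^ T * max 1 (cmod (b i)) ^ T)"
  have T1: "1 \<le> real T ^ 2 * H" using T H mult_mono[of 1 "real T ^ 2" 1 H] by simp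
  have w1: "w i \<ge> 1" for i
  proof -
    have "1 * 1 * 1 \<le> real T ^ 2 * H * max 1 (cmod (a i)) ^ T * max 1 (cmod (b i)) ^ T"
      using H by (intro mult_mono T1) auto
    thus ?thesis by (simp add: w_def)
  qed
  have zw: "cmod (z i) \<le> w i" for i
  proof -
    have "cmod (z i) \<le> (\<Sum>(k,l)\<in>{..<T} \<times> {..<T}. H * max 1 (cmod (a i)) ^ T * max 1 (cmod (b i)) ^ T)"
      unfolding z_eq
    proof (rule sum_norm_le)
      fix s assume "s \<in> {..<T} \<times> {..<T}"
      then obtain k l where kl: "s = (k, l)" "k < T" "l < T" by auto
      have pw: "cmod y ^ j \<le> max 1 (cmod y) ^ T" if "j < T" for j and y :: complex
        using power_mono[of "cmod y" "max 1 (cmod y)" j] power_increasing[of j T "max 1 (cmod y)"] that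
        by simp
      have "cmod (of_int (p k l) * a i ^ k * b i ^ l) = \<bar>real_of_int (p k l)\<bar> * cmod (a i) ^ k * cmod (b i) ^ l"
        by (simp add: norm_mult norm_power)
      also have "\<dots> \<le> H * max 1 (cmod (a i)) ^ T * max 1 (cmod (b i)) ^ T"
        using kl H by (intro mult_mono pw pH) auto
      finally show "cmod (case s of (k, l) \<Rightarrow> of_int (p k l) * a i ^ k * b i ^ l)
          \<le> (case s of (k, l) \<Rightarrow> H * max 1 (cmod (a i)) ^ T * max 1 (cmod (b i)) ^ T)"
        by (simp add: kl(1))
    qed
    also have "\<dots> = w i" by (simp add: w_def power2_eq_square)
    finally show ?thesis .
  qed
  \<comment> \<open>The factor at \<theta> itself is x and is kept; the others are bounded by
    \<open>w i\<close>. Then \<open>w i0\<close>, which is at least 1, is put back so that the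
    product runs over all conjugates.\<close>
  obtain i0 where i0: "i0 < n" "\<theta> = \<rho> i0" using D(3) unfolding \<rho> by (auto simp: poly_prod)
  have "cmod N = cmod x * (\<Prod>i\<in>{..<n} - {i0}. cmod (z i))"
    unfolding N_def using i0 G\<theta> by (subst prod.remove[of _ i0]) (auto simp: norm_mult prod_norm z_def)
  also have "(\<Prod>i\<in>{..<n} - {i0}. cmod (z i)) \<le> (\<Prod>i\<in>{..<n} - {i0}. w i)"
    using zw by (intro prod_mono) auto
  also have "\<dots> \<le> w i0 * (\<Prod>i\<in>{..<n} - {i0}. w i)"
    using w1[of i0] prod_ge_1[of "{..<n} - {i0}" w] w1 by (simp add: mult_le_cancel_right1)
  also have "\<dots> = (\<Prod>i<n. w i)" using i0 by (subst (2) prod.remove[of _ i0]) auto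
  also have "\<dots> = (real T ^ 2 * H) ^ n * (\<Prod>i<n. max 1 (cmod (a i))) ^ T * (\<Prod>i<n. max 1 (cmod (b i))) ^ T"
    by (simp add: w_def prod.distrib prod_power_distrib)
  finally have "cmod N \<le> cmod x * ((real T ^ 2 * H) ^ n * (\<Prod>i<n. max 1 (cmod (a i))) ^ T * (\<Prod>i<n. max 1 (cmod (b i))) ^ T)"
    by (simp add: mult_left_mono)
  hence "cmod (of_int c ^ T * of_int d ^ T * N) \<le> \<bar>real_of_int c\<bar> ^ T * \<bar>real_of_int d\<bar> ^ T *
      (cmod x * ((real T ^ 2 * H) ^ n * (\<Prod>i<n. max 1 (cmod (a i))) ^ T * (\<Prod>i<n. max 1 (cmod (b i))) ^ T))"
    by (simp add: norm_mult norm_power mult_left_mono)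
  also have "\<dots> = cmod x * (real T ^ 2 * H) ^ n * (\<bar>real_of_int c\<bar> * (\<Prod>i<n. max 1 (cmod (a i)))) ^ T
      * (\<bar>real_of_int d\<bar> * (\<Prod>i<n. max 1 (cmod (b i)))) ^ T"
    by (simp add: power_mult_distrib mult_ac)
  finally show ?thesis using ge1 unfolding c(3) d(3) by linarith
qed

section \<open>Simple extensions and primitive elements\<close>

lemma ex_int_mult_algebraic_int:
  assumes "algebraic (x::complex)"
  obtains a :: int where "a \<noteq> 0" "algebraic_int (of_int a * x)"
proof -
  define P where "P = (map_poly of_int (int_min_poly x) :: complex poly)"
  note p = int_min_poly_props[OF assms]
  have lc: "lead_coeff P = of_int (lead_coeff (int_min_poly x))" by (simp add: P_def)
  obtain \<rho> where \<rho>: "P = smult (lead_coeff P) (\<Prod>i<degree P. [:-\<rho> i, 1:])"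
    using complex_factorization[of P] by blast
  have "poly P x = 0" using p(3) by (simp add: P_def)
  hence "poly (smult (lead_coeff P) (\<Prod>i<degree P. [:-\<rho> i, 1:])) x = 0" unfolding \<rho>[symmetric] .
  moreover have "P \<noteq> 0" using p(2) lc by auto
  ultimately have "poly (\<Prod>i<degree P. [:-\<rho> i, 1:]) x = 0" by simp
  then obtain i where i: "i < degree P" "x = \<rho> i" by (auto simp: poly_prod)
  have "coeffs_in {x. algebraic_int x} P"
    using csubring_of_int[OF csubring_algebraic_int] by (simp add: coeffs_in_def P_def)
  hence "coeffs_in {x. algebraic_int x} (smult (lead_coeff P) (\<Prod>i<degree P. [:-\<rho> i, 1:]))"
    unfolding \<rho>[symmetric] .
  from algebraic_int_subset_prod[OF _ this, of "{i}"] i have "algebraic_int (lead_coeff P * x)" by simp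
  hence "algebraic_int (of_int (lead_coeff (int_min_poly x)) * x)" by (simp only: lc)
  moreover have "lead_coeff (int_min_poly x) \<noteq> 0" using p(2) by linarith
  ultimately show ?thesis using that by blast
qed

lemma csubring_Ints: "csubring \<int>"
  by (simp add: csubring_def)

lemma algebraic_if_int_mult:
  assumes "a \<noteq> 0" "algebraic_int (of_int a * x)"
  shows "algebraic (x::complex)"
proof -
  obtain p where p: "lead_coeff p = 1" "\<forall>i. coeff p i \<in> \<int>" "poly p (of_int a * x) = 0"
    using assms(2) by (auto elim: algebraic_int.cases)
  show ?thesis
  proof (rule algebraicI)
    have "coeffs_in \<int> (pcompose p [:0, of_int a:])"
      using p(2) by (intro coeffs_in_pcompose[OF csubring_Ints] coeffs_in_pCons[OF csubring_Ints]
        coeffs_in_0[OF csubring_Ints]) (auto simp: coeffs_in_def)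
    thus "coeff (pcompose p [:0, of_int a:]) i \<in> \<int>" for i by (simp add: coeffs_in_def)
    show "poly (pcompose p [:0, of_int a:]) x = 0" using p(3) by (simp add: poly_pcompose mult.commute)
    have "p \<noteq> 0" using p(1) by auto
    thus "pcompose p [:0, of_int a:] \<noteq> 0" using assms(1) pcompose_eq_0[of p "[:0, of_int a:]"] by auto
  qed
qed

text \<open>With denominators cleared, the sum is formed in the ring of algebraic integers.\<close>

lemma algebraic_add_nat_mult:
  assumes "algebraic x" "algebraic y"
  shows "algebraic (x + of_nat c * y :: complex)"
proof -
  note R = csubring_algebraic_int
  obtain a where a: "a \<noteq> 0" "algebraic_int (of_int a * x)" using ex_int_mult_algebraic_int[OF assms(1)] .
  obtain b where b: "b \<noteq> 0" "algebraic_int (of_int b * y)" using ex_int_mult_algebraic_int[OF assms(2)] .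
  have "of_int b * (of_int a * x) + of_int (a * int c) * (of_int b * y) \<in> {x. algebraic_int x}"
    by (rule csubring_add[OF R csubring_mult[OF R csubring_of_int[OF R]]
      csubring_mult[OF R csubring_of_int[OF R]]]) (use a b in auto)
  also have "of_int b * (of_int a * x) + of_int (a * int c) * (of_int b * y) = of_int (a * b) * (x + of_nat c * y)"
    by (simp only: of_int_mult of_int_of_nat_eq distrib_left mult_ac)
  finally have "algebraic_int (of_int (a * b) * (x + of_nat c * y))" by (simp only: mem_Collect_eq)
  moreover have "a * b \<noteq> 0" using a(1) b(1) by simp
  ultimately show ?thesis by (rule algebraic_if_int_mult[rotated])
qed

definition simple_ext :: "complex \<Rightarrow> complex set" where
  "simple_ext \<theta> = {poly p \<theta> |p. coeffs_in \<rat> p}"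

lemma csubfield_simple_ext:
  assumes "algebraic \<theta>"
  shows "csubfield (simple_ext \<theta>)"
proof -
  note R = csubring_Rats
  obtain m where m: "is_min_poly m \<theta>" using ex_min_poly[OF assms] .
  note D = is_min_polyD[OF m]
  have in_ext: "poly p \<theta> \<in> simple_ext \<theta>" if "coeffs_in \<rat> p" for p
    using that by (auto simp: simple_ext_def)
  show ?thesis unfolding csubfield_def csubring_def
  proof (intro conjI ballI)
    show "1 \<in> simple_ext \<theta>" using in_ext[OF coeffs_in_1[OF R]] by simp
    fix x assume "x \<in> simple_ext \<theta>"
    then obtain p where p: "coeffs_in \<rat> p" "x = poly p \<theta>" by (auto simp: simple_ext_def)
    {
      fix y assume "y \<in> simple_ext \<theta>"
      then obtain q where q: "coeffs_in \<rat> q" "y = poly q \<theta>" by (auto simp: simple_ext_def)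
      show "x - y \<in> simple_ext \<theta>" using in_ext[OF coeffs_in_diff[OF R p(1) q(1)]] p q by simp
      show "x * y \<in> simple_ext \<theta>" using in_ext[OF coeffs_in_mult[OF R p(1) q(1)]] p q by simp
    }
    show "inverse x \<in> simple_ext \<theta>"
    proof (cases "x = 0")
      case True
      thus ?thesis using in_ext[OF coeffs_in_0[OF R]] by simp
    next
      case False
      \<comment> \<open>Since p does not vanish at \<theta>, its gcd w with m is 1, and the Bezout
        coefficient v supplies the inverse.\<close>
      obtain u v w where w: "coeffs_in \<rat> u" "coeffs_in \<rat> v" "coeffs_in \<rat> w" "lead_coeff w = 1"
        "w = u * m + v * p" "w dvd m" "w dvd p"
        using csubfield_bezout[OF csubfield_Rats D(1) p(1) D(4)] by blast
      obtain h where h: "coeffs_in \<rat> h" "m = h * w"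
        using coeffs_in_dvd[OF R w(3,4) D(1) w(6)] by blast
      have "poly w \<theta> \<noteq> 0" using w(7) False p(2) by auto
      moreover have "poly h \<theta> * poly w \<theta> = 0" using D(3) h(2) by (metis poly_mult)
      ultimately have "m dvd h" using D(5)[OF h(1)] by simp
      have h0: "h \<noteq> 0" and w0: "w \<noteq> 0" using h(2) D(4) by auto
      have "degree m \<le> degree h" using \<open>m dvd h\<close> h0 by (rule dvd_imp_degree_le)
      hence "degree w = 0" using degree_mult_eq[OF h0 w0] unfolding h(2) by simp
      then obtain c where "w = [:c:]" by (rule degree_eq_zeroE)
      hence "poly w \<theta> = 1" using w(4) by simp
      hence "poly v \<theta> * x = 1" unfolding w(5) using D(3) p(2) by simp
      hence "inverse x = poly v \<theta>" using False by (simp add: field_simps)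
      thus ?thesis using in_ext[OF w(2)] by simp
    qed
  qed
qed

lemma poly_only_root:
  fixes w :: "complex poly"
  assumes "lead_coeff w = 1" and "\<And>b. poly w b = 0 \<Longrightarrow> b = \<beta>"
  shows "w = [:-\<beta>, 1:] ^ degree w"
proof -
  obtain \<rho> where \<rho>: "w = smult (lead_coeff w) (\<Prod>i<degree w. [:-\<rho> i, 1:])"
    using complex_factorization[of w] by blast
  hence w: "w = (\<Prod>i<degree w. [:-\<rho> i, 1:])" unfolding assms(1) smult_1_left .
  have "\<rho> i = \<beta>" if "i < degree w" for i
  proof (rule assms(2))
    show "poly w (\<rho> i) = 0" using that by (subst w) (auto simp: poly_prod)
  qed
  hence eq: "(\<Prod>i<degree w. [:-\<rho> i, 1:]) = (\<Prod>i<degree w. [:-\<beta>, 1:])" by (intro prod.cong) auto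
  show ?thesis using w unfolding eq prod_constant card_lessThan .
qed

text \<open>Over K = Q(\<theta>) the polynomials g(X) and f(\<theta> - c X) have only the root
  \<beta> in common, and it is simple in g; so their gcd over K is X - \<beta>, and \<beta> lies in
  K.\<close>

lemma primitive_element:
  assumes alg: "algebraic \<alpha>" "algebraic \<beta>"
  obtains c :: nat where "\<alpha> \<in> simple_ext (\<alpha> + of_nat c * \<beta>)" "\<beta> \<in> simple_ext (\<alpha> + of_nat c * \<beta>)"
proof -
  obtain f where f: "is_min_poly f \<alpha>" using ex_min_poly[OF alg(1)] .
  obtain g where g: "is_min_poly g \<beta>" using ex_min_poly[OF alg(2)] .
  note Df = is_min_polyD[OF f] and Dg = is_min_polyD[OF g]
  \<comment> \<open>These are the c with a + c b = \<alpha> + c \<beta> for conjugates a, b with b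
    different from \<beta>. For b = \<beta> the division by zero contributes 0, which merely
    excludes c = 0.\<close>
  define bad where "bad = (\<lambda>(a, b). (a - \<alpha>) / (\<beta> - b)) ` ({a. poly f a = 0} \<times> {b. poly g b = 0})"
  have "finite bad" unfolding bad_def using Df(4) Dg(4) poly_roots_finite by blast
  moreover have "infinite (range (of_nat :: nat \<Rightarrow> complex))"
    by (rule range_inj_infinite) (simp add: inj_on_def)
  ultimately have "\<not> range (of_nat :: nat \<Rightarrow> complex) \<subseteq> bad" by (metis finite_subset)
  then obtain c :: nat where c: "of_nat c \<notin> bad" by blast
  define \<theta> where "\<theta> = \<alpha> + of_nat c * \<beta>"
  define K where "K = simple_ext \<theta>"
  have alg\<theta>: "algebraic \<theta>" unfolding \<theta>_def by (rule algebraic_add_nat_mult[OF alg])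
  have K: "csubfield K" unfolding K_def by (rule csubfield_simple_ext[OF alg\<theta>])
  hence R: "csubring K" by (simp add: csubfield_def)
  have Rats_K: "\<rat> \<subseteq> K"
  proof
    fix x :: complex assume "x \<in> \<rat>"
    thus "x \<in> K" unfolding K_def simple_ext_def using coeffs_in_const[OF csubring_Rats]
      by (auto intro!: exI[of _ "[:x:]"])
  qed
  have \<theta>K: "\<theta> \<in> K" unfolding K_def simple_ext_def
    by (auto intro!: exI[of _ "[:0, 1:]"] coeffs_in_pCons[OF csubring_Rats] coeffs_in_0[OF csubring_Rats])
  have coeffs_K: "coeffs_in K q" if "coeffs_in \<rat> q" for q
    using that Rats_K unfolding coeffs_in_def by blast
  define h where "h = pcompose f [:\<theta>, - of_nat c:]"
  have cK: "of_nat c \<in> K" using csubring_of_int[OF R, of "int c"] by simp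
  have hK: "coeffs_in K h" unfolding h_def
    by (intro coeffs_in_pcompose[OF R] coeffs_K Df(1) coeffs_in_pCons[OF R] coeffs_in_0[OF R]
      csubring_uminus[OF R] cK \<theta>K)
  obtain u v w where w: "coeffs_in K u" "coeffs_in K v" "coeffs_in K w" "lead_coeff w = 1"
      "w = u * g + v * h" "w dvd g" "w dvd h"
    using csubfield_bezout[OF K coeffs_K[OF Dg(1)] hK Dg(4)] by blast
  have "poly h \<beta> = 0" using Df(3) by (simp add: h_def poly_pcompose \<theta>_def algebra_simps)
  hence w\<beta>: "poly w \<beta> = 0" unfolding w(5) using Dg(3) by simp
  have only: "b = \<beta>" if b: "poly w b = 0" for b
  proof (rule ccontr)
    assume ne: "b \<noteq> \<beta>"
    have "poly g b = 0" using w(6) b by (auto elim: dvdE)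
    moreover have "poly h b = 0" using w(7) b by (auto elim: dvdE)
    hence "poly f (\<theta> - of_nat c * b) = 0" by (simp add: h_def poly_pcompose algebra_simps)
    ultimately have "(\<theta> - of_nat c * b - \<alpha>) / (\<beta> - b) \<in> bad" by (force simp: bad_def)
    moreover have "(\<theta> - of_nat c * b - \<alpha>) / (\<beta> - b) = of_nat c"
      using ne by (simp add: \<theta>_def field_simps)
    ultimately show False using c by simp
  qed
  have wpow: "w = [:-\<beta>, 1:] ^ degree w" by (rule poly_only_root[OF w(4) only])
  text \<open>\<open>\<beta>\<close> is a simple root of \<open>g\<close>, because \<open>g\<close> does not divide its derivative.\<close>
  have "\<not> degree w \<ge> 2"
  proof
    assume "degree w \<ge> 2"
    hence "[:-\<beta>, 1:] ^ 2 dvd w" by (subst wpow) (rule le_imp_power_dvd)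
    hence "[:-\<beta>, 1:] ^ 2 dvd g" using w(6) by (rule dvd_trans)
    then obtain q where "g = [:-\<beta>, 1:] ^ 2 * q" by (elim dvdE)
    hence gq: "g = [:-\<beta>, 1:] * ([:-\<beta>, 1:] * q)" unfolding power2_eq_square mult.assoc .
    have "poly (pderiv g) \<beta> = 0" unfolding gq pderiv_mult poly_add poly_mult by simp
    moreover have "coeffs_in \<rat> (pderiv g)"
      using Dg(1) by (auto simp: coeffs_in_def coeff_pderiv)
    ultimately have "g dvd pderiv g" using Dg(5) by blast
    moreover have "degree g \<noteq> 0"
    proof
      assume "degree g = 0"
      then obtain c where "g = [:c:]" by (rule degree_eq_zeroE)
      thus False using Dg(2,3) by simp
    qed
    ultimately show False using not_dvd_pderiv[of g] by simp
  qed
  moreover have "degree w \<noteq> 0" using wpow w\<beta> by (metis poly_1 power_0 zero_neq_one)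
  ultimately have "degree w = 1" by linarith
  hence "w = [:-\<beta>, 1:]" using wpow by simp
  hence "coeff w 0 = -\<beta>" by simp
  hence "-\<beta> \<in> K" using w(3) unfolding coeffs_in_def by metis
  hence \<beta>K: "\<beta> \<in> K" using csubring_uminus[OF R, of "-\<beta>"] by simp
  have "\<theta> - of_nat c * \<beta> \<in> K" by (intro csubring_diff[OF R] csubring_mult[OF R] \<theta>K cK \<beta>K)
  hence "\<alpha> \<in> K" by (simp add: \<theta>_def)
  thus ?thesis using that[of c] \<beta>K by (simp add: K_def \<theta>_def)
qed

section \<open>The degree of Q(\<alpha>, \<beta>) as a vector space dimension\<close>

lemma complex_ring_simps:
  "carrier complex_ring = UNIV" "\<zero>\<^bsub>complex_ring\<^esub> = 0" "\<one>\<^bsub>complex_ring\<^esub> = 1"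
  "x \<otimes>\<^bsub>complex_ring\<^esub> y = x * y" "x \<oplus>\<^bsub>complex_ring\<^esub> y = x + y"
  by (auto simp: ring_of_type_algebra_def)

lemma complex_ring_uminus: "\<ominus>\<^bsub>complex_ring\<^esub> x = - x"
proof -
  interpret C: Ring.field complex_ring by (rule field_from_type_algebra)
  show ?thesis using C.minus_equality[of "-x" x] by (auto simp: complex_ring_simps)
qed

lemma complex_ring_inverse: "x \<noteq> 0 \<Longrightarrow> inv\<^bsub>complex_ring\<^esub> x = inverse x"
proof -
  interpret C: Ring.field complex_ring by (rule field_from_type_algebra)
  show "x \<noteq> 0 \<Longrightarrow> ?thesis" by (intro C.comm_inv_char) (auto simp: complex_ring_simps)
qed

lemma csubfield_imp_subfield:
  assumes "csubfield K"
  shows "subfield K complex_ring"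
proof -
  interpret C: Ring.field complex_ring by (rule field_from_type_algebra)
  have R: "csubring K" using assms by (simp add: csubfield_def)
  show ?thesis
  proof (rule C.subfieldI')
  show "subring K complex_ring"
    using csubring_1[OF R] csubring_mult[OF R] csubring_add[OF R] csubring_uminus[OF R]
    by (intro C.subringI) (auto simp: complex_ring_simps complex_ring_uminus)
  show "inv\<^bsub>complex_ring\<^esub> k \<in> K" if "k \<in> K - {\<zero>\<^bsub>complex_ring\<^esub>}" for k
    using that assms by (auto simp: complex_ring_simps complex_ring_inverse csubfield_def)
  qed
qed

lemma subfield_imp_csubring:
  assumes "subfield K complex_ring"
  shows "csubring K"
proof -
  have s: "subring K complex_ring" using subfieldE(1)[OF assms] subcring.axioms(1) by blast
  have "x - y \<in> K" if "x \<in> K" "y \<in> K" for x y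
    using subringE(7)[OF s that(1) subringE(5)[OF s that(2)]]
    by (simp add: complex_ring_simps complex_ring_uminus)
  thus ?thesis using subringE(3,6)[OF s] by (auto simp: csubring_def complex_ring_simps)
qed

lemma Q_adjoin_eq_simple_ext:
  assumes alg: "algebraic \<theta>" and \<theta>: "\<theta> = \<alpha> + of_nat c * \<beta>"
    and mem: "\<alpha> \<in> simple_ext \<theta>" "\<beta> \<in> simple_ext \<theta>"
  shows "Q_adjoin {\<alpha>, \<beta>} = simple_ext \<theta>"
proof
  interpret C: Ring.field complex_ring by (rule field_from_type_algebra)
  have Rats: "\<rat> \<subseteq> simple_ext \<theta>"
  proof
    fix x :: complex assume "x \<in> \<rat>"
    thus "x \<in> simple_ext \<theta>" unfolding simple_ext_def using coeffs_in_const[OF csubring_Rats]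
      by (auto intro!: exI[of _ "[:x:]"])
  qed
  show "Q_adjoin {\<alpha>, \<beta>} \<subseteq> simple_ext \<theta>" unfolding Q_adjoin_def
    using Rats mem csubfield_imp_subfield[OF csubfield_simple_ext[OF alg]]
    by (intro C.generate_field_min_subfield1) (auto simp: complex_ring_simps)
  define E where "E = Q_adjoin {\<alpha>, \<beta>}"
  have R: "csubring E" unfolding E_def Q_adjoin_def
    by (intro subfield_imp_csubring C.generate_field_is_subfield) (simp add: complex_ring_simps)
  have incl: "\<rat> \<union> {\<alpha>, \<beta>} \<subseteq> E" unfolding E_def Q_adjoin_def
    by (auto intro: generate_field.incl)
  have "of_nat c \<in> E" using csubring_of_int[OF R, of "int c"] by simp
  hence "\<theta> \<in> E" unfolding \<theta> using incl by (intro csubring_add[OF R] csubring_mult[OF R]) auto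
  thus "simple_ext \<theta> \<subseteq> Q_adjoin {\<alpha>, \<beta>}"
    using poly_in[OF R] incl unfolding E_def[symmetric] simple_ext_def coeffs_in_def by blast
qed

text \<open>\<open>combine\<close> stops at the end of the shorter list, hence
  \<open>take n\<close>; the offset j is there for the induction.\<close>

lemma combine_powers:
  "ring.combine complex_ring Ks (map (\<lambda>i. \<theta> ^ i) [j..<j+n]) = \<theta> ^ j * poly (Poly (take n Ks)) \<theta>"
proof (induction n arbitrary: Ks j)
  interpret C: Ring.field complex_ring by (rule field_from_type_algebra)
  case 0
  show ?case by (simp add: complex_ring_simps)
next
  interpret C: Ring.field complex_ring by (rule field_from_type_algebra)
  case (Suc n)
  have "[j..<j + Suc n] = j # [Suc j..<Suc j + n]" by (simp add: upt_conv_Cons)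
  thus ?case using Suc[of "tl Ks" "Suc j"]
    by (cases Ks) (auto simp: complex_ring_simps algebra_simps)
qed

text \<open>The powers of \<theta> below the degree of m form a basis: a linear relation is a
  polynomial of too small a degree to be divisible by m unless it is 0, and reduction modulo m shows
  that they span.\<close>

lemma degree_over_Q_simple_ext:
  assumes m: "is_min_poly m \<theta>"
  shows "degree_over_Q (simple_ext \<theta>) = degree m"
proof -
  interpret C: Ring.field complex_ring by (rule field_from_type_algebra)
  note D = is_min_polyD[OF m]
  define n where "n = degree m"
  define Us where "Us = map (\<lambda>i. \<theta> ^ i) [0..<n]"
  have comb: "C.combine Ks Us = poly (Poly (take n Ks)) \<theta>" for Ks
    using combine_powers[of Ks \<theta> 0 n] by (simp add: Us_def)
  have len: "length Us = n" by (simp add: Us_def)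
  have PolyQ: "coeffs_in \<rat> (Poly Ks)" if "set Ks \<subseteq> \<rat>" for Ks
    using that by (auto simp: coeffs_in_def coeff_Poly_eq nth_default_def)
  have degPoly: "Poly (take n Ks) = 0 \<or> degree (Poly (take n Ks)) < n" for Ks :: "complex list"
  proof (rule disjCI)
    assume ne: "\<not> degree (Poly (take n Ks)) < n"
    hence "coeff (Poly (take n Ks)) (degree (Poly (take n Ks))) = 0"
      by (simp add: coeff_Poly_eq nth_default_def)
    thus "Poly (take n Ks) = 0" by (simp only: leading_coeff_0_iff)
  qed
  have indep: "C.independent \<rat> Us"
  proof (rule C.trivial_combine_imp_independent[OF subfield_Rats_complex])
    show "set Us \<subseteq> carrier complex_ring" by (simp add: complex_ring_simps)
    fix Ks assume Ks: "set Ks \<subseteq> \<rat>" "C.combine Ks Us = \<zero>\<^bsub>complex_ring\<^esub>"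
    have "poly (Poly (take n Ks)) \<theta> = 0" using Ks(2) comb by (simp add: complex_ring_simps)
    moreover have "coeffs_in \<rat> (Poly (take n Ks))"
      using Ks(1) set_take_subset[of n Ks] by (intro PolyQ) blast
    ultimately have "m dvd Poly (take n Ks)" using D(5) by blast
    hence "Poly (take n Ks) = 0"
      using degPoly[of Ks] dvd_imp_degree_le[of m "Poly (take n Ks)"] unfolding n_def by linarith
    thus "set (take (length Us) Ks) \<subseteq> {\<zero>\<^bsub>complex_ring\<^esub>}"
      unfolding Poly_eq_0 len by (auto simp: complex_ring_simps)
  qed
  have "C.Span \<rat> Us = simple_ext \<theta>"
  proof -
    have "C.Span \<rat> Us = {C.combine Ks Us |Ks. set Ks \<subseteq> \<rat>}"
      by (rule C.Span_eq_combine_set[OF subfield_Rats_complex]) (simp add: complex_ring_simps)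
    also have "\<dots> = simple_ext \<theta>"
    proof (intro equalityI subsetI)
      fix x assume "x \<in> {C.combine Ks Us |Ks. set Ks \<subseteq> \<rat>}"
      then obtain Ks where Ks: "set Ks \<subseteq> \<rat>" "x = poly (Poly (take n Ks)) \<theta>" by (auto simp: comb)
      thus "x \<in> simple_ext \<theta>" unfolding simple_ext_def
        using PolyQ[of "take n Ks"] set_take_subset[of n Ks] by blast
    next
      fix x assume "x \<in> simple_ext \<theta>"
      then obtain p where p: "coeffs_in \<rat> p" "x = poly p \<theta>" by (auto simp: simple_ext_def)
      obtain q r where qr: "coeffs_in \<rat> r" "p = q * m + r" "r = 0 \<or> degree r < degree m"
        using coeffs_in_division[OF csubring_Rats D(1,2) p(1)] by blast
      define Ks where "Ks = map (coeff r) [0..<n]"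
      have "coeff r i = 0" if "\<not> i < n" for i
        using that qr(3) by (cases "r = 0") (auto simp: n_def intro: coeff_eq_0)
      hence "Poly Ks = r"
        by (intro poly_eqI) (auto simp: Ks_def coeff_Poly_eq nth_default_def)
      moreover have "take n Ks = Ks" by (simp add: Ks_def)
      ultimately have "x = C.combine Ks Us" using D(3) by (simp add: comb p(2) qr(2))
      moreover have "set Ks \<subseteq> \<rat>" using qr(1) by (auto simp: Ks_def coeffs_in_def)
      ultimately show "x \<in> {C.combine Ks Us |Ks. set Ks \<subseteq> \<rat>}" by blast
    qed
    finally show ?thesis .
  qed
  hence "C.dimension n \<rat> (simple_ext \<theta>)"
    using C.dimensionI[OF subfield_Rats_complex indep] by (simp add: len)
  thus ?thesis using C.dimI[OF subfield_Rats_complex]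
    unfolding degree_over_Q_def n_def over_def by blast
qed

text \<open>The true degree may be replaced by the upper bound D because the base of the power is at
  least 1, heights being nonnegative.\<close>

lemma liouville:
  fixes p :: "nat \<Rightarrow> nat \<Rightarrow> int" and H :: real
  assumes alg: "algebraic \<alpha>" "algebraic \<beta>" and D: "degree_over_Q (Q_adjoin {\<alpha>, \<beta>}) \<le> D"
    and T: "T \<ge> 1" and H: "H \<ge> 1" and pH: "\<And>k l. k < T \<Longrightarrow> l < T \<Longrightarrow> \<bar>real_of_int (p k l)\<bar> \<le> H"
    and x: "x = (\<Sum>k<T. \<Sum>l<T. of_int (p k l) * \<alpha> ^ k * \<beta> ^ l)" and x0: "x \<noteq> 0"
  shows "1 \<le> cmod x * (real T ^ 2 * H * exp (real T * (abs_log_height \<alpha> + abs_log_height \<beta>))) ^ D"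
proof -
  obtain c where c: "\<alpha> \<in> simple_ext (\<alpha> + of_nat c * \<beta>)" "\<beta> \<in> simple_ext (\<alpha> + of_nat c * \<beta>)"
    using primitive_element[OF alg] .
  define \<theta> where "\<theta> = \<alpha> + of_nat c * \<beta>"
  have alg\<theta>: "algebraic \<theta>" unfolding \<theta>_def by (rule algebraic_add_nat_mult[OF alg])
  obtain m where m: "is_min_poly m \<theta>" using ex_min_poly[OF alg\<theta>] .
  have "Q_adjoin {\<alpha>, \<beta>} = simple_ext \<theta>"
    using c by (intro Q_adjoin_eq_simple_ext[OF alg\<theta> \<theta>_def]) (simp_all add: \<theta>_def)
  hence nD: "degree m \<le> D" using D degree_over_Q_simple_ext[OF m] by simp
  obtain A B where A: "coeffs_in \<rat> A" "poly A \<theta> = \<alpha>" and B: "coeffs_in \<rat> B" "poly B \<theta> = \<beta>"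
    using c unfolding \<theta>_def[symmetric] simple_ext_def by blast
  let ?n = "degree m"
  let ?B = "real T ^ 2 * H * exp (real T * (abs_log_height \<alpha> + abs_log_height \<beta>))"
  have "1 \<le> cmod x * (real T ^ 2 * H) ^ ?n * exp (real ?n * abs_log_height \<alpha>) ^ T
           * exp (real ?n * abs_log_height \<beta>) ^ T"
    by (rule liouville_primitive[OF m refl A B alg T H pH x x0])
  also have "\<dots> = cmod x * ?B ^ ?n"
    by (simp add: power_mult_distrib exp_add distrib_left flip: exp_of_nat_mult) (simp add: mult_ac)
  also have "\<dots> \<le> cmod x * ?B ^ D"
  proof (intro mult_left_mono power_increasing nD)
    have "1 * 1 * 1 \<le> ?B"
      using T H abs_log_height_nonneg[OF alg(1)] abs_log_height_nonneg[OF alg(2)]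
      by (intro mult_mono) auto
    thus "1 \<le> ?B" by simp
  qed simp
  finally show ?thesis .
qed

section \<open>Small integer combinations and the Schwarz lemma\<close>

text \<open>Dirichlet's box principle: rounding a form with values in [-S, S] to multiples of S / l
  leaves the 2 l + 1 values from -l to l. Two points of {0..H}^J are then rounded alike, and the
  entries of their difference are at most H in absolute value.\<close>

lemma pigeonhole_small_forms:
  fixes u :: "'i \<Rightarrow> 'j \<Rightarrow> real" and H l :: nat
  assumes fin: "finite I" "finite J" and S: "S > 0" and l: "l \<ge> 1"
    and bound: "\<And>i. i \<in> I \<Longrightarrow> (\<Sum>j\<in>J. \<bar>u i j\<bar>) * real H \<le> S"
    and count: "(2 * l + 1) ^ card I < (H + 1) ^ card J"
  obtains x :: "'j \<Rightarrow> int" where "\<exists>j\<in>J. x j \<noteq> 0" "\<And>j. j \<in> J \<Longrightarrow> \<bar>x j\<bar> \<le> int H"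
    "\<And>i. i \<in> I \<Longrightarrow> \<bar>\<Sum>j\<in>J. u i j * real_of_int (x j)\<bar> \<le> S / real l"
proof -
  define Xs where "Xs = PiE J (\<lambda>_. {0..H})"
  define Y where "Y = PiE I (\<lambda>_. {- int l..int l})"
  define v where "v = (\<lambda>i (x :: 'j \<Rightarrow> nat). (\<Sum>j\<in>J. u i j * real (x j)))"
  define \<Phi> where "\<Phi> = (\<lambda>x. \<lambda>i\<in>I. \<lfloor>v i x * real l / S\<rfloor>)"
  have v_bound: "\<bar>v i x\<bar> \<le> S" if "i \<in> I" "x \<in> Xs" for i x
  proof -
    have "\<bar>v i x\<bar> \<le> (\<Sum>j\<in>J. \<bar>u i j * real (x j)\<bar>)" unfolding v_def by (rule sum_abs)
    also have "\<dots> \<le> (\<Sum>j\<in>J. \<bar>u i j\<bar> * real H)"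
    proof (rule sum_mono)
      fix j assume "j \<in> J"
      hence "x j \<le> H" using that(2) unfolding Xs_def by auto
      thus "\<bar>u i j * real (x j)\<bar> \<le> \<bar>u i j\<bar> * real H" by (simp add: abs_mult mult_left_mono)
    qed
    also have "\<dots> = (\<Sum>j\<in>J. \<bar>u i j\<bar>) * real H" by (simp add: sum_distrib_right)
    finally show ?thesis using bound[OF that(1)] by linarith
  qed
  have "\<Phi> x \<in> Y" if x: "x \<in> Xs" for x
    unfolding \<Phi>_def Y_def
  proof (rule restrict_PiE_iff[THEN iffD2], safe)
    fix i assume "i \<in> I"
    hence b: "\<bar>v i x\<bar> \<le> S" using v_bound x by blast
    have "\<bar>v i x * real l / S\<bar> = \<bar>v i x\<bar> * real l / S" using S by (simp add: abs_mult)
    also have "\<dots> \<le> S * real l / S" using b S by (intro divide_right_mono mult_right_mono) auto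
    also have "\<dots> = real l" using S by simp
    finally have "\<bar>v i x * real l / S\<bar> \<le> real l" .
    hence "- real l \<le> v i x * real l / S" "v i x * real l / S \<le> real l" by linarith+
    thus "\<lfloor>v i x * real l / S\<rfloor> \<in> {- int l..int l}" unfolding atLeastAtMost_iff by linarith
  qed
  hence img: "\<Phi> ` Xs \<subseteq> Y" by blast
  have "card Y = (2 * l + 1) ^ card I" unfolding Y_def using fin(1)
    by (subst card_PiE) (auto simp: nat_add_distrib nat_mult_distrib)
  moreover have "card Xs = (H + 1) ^ card J" unfolding Xs_def using fin(2) by (subst card_PiE) auto
  moreover have "finite Y" unfolding Y_def using fin(1) by (intro finite_PiE) auto
  ultimately have "\<not> inj_on \<Phi> Xs" using count card_inj_on_le[OF _ img] by linarith
  then obtain x y where xy: "x \<in> Xs" "y \<in> Xs" "x \<noteq> y" "\<Phi> x = \<Phi> y" by (auto simp: inj_on_def)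
  show ?thesis
  proof (rule that[of "\<lambda>j. int (x j) - int (y j)"])
    have "\<exists>j\<in>J. x j \<noteq> y j" using xy(1-3) unfolding Xs_def by (meson PiE_ext)
    thus "\<exists>j\<in>J. int (x j) - int (y j) \<noteq> 0" by auto
    show "\<bar>int (x j) - int (y j)\<bar> \<le> int H" if "j \<in> J" for j
    proof -
      have "x j \<le> H" "y j \<le> H" using xy(1,2) that unfolding Xs_def by auto
      thus ?thesis by linarith
    qed
    show "\<bar>\<Sum>j\<in>J. u i j * real_of_int (int (x j) - int (y j))\<bar> \<le> S / real l" if i: "i \<in> I" for i
    proof -
      have eq: "(\<Sum>j\<in>J. u i j * real_of_int (int (x j) - int (y j))) = v i x - v i y"
        by (simp add: v_def right_diff_distrib sum_subtractf)
      have "\<lfloor>v i x * real l / S\<rfloor> = \<lfloor>v i y * real l / S\<rfloor>"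
        using fun_cong[OF xy(4), of i] i by (simp add: \<Phi>_def)
      hence "\<bar>v i x * real l / S - v i y * real l / S\<bar> \<le> 1" by linarith
      moreover have "v i x * real l / S - v i y * real l / S = (v i x - v i y) * (real l / S)"
        by (simp add: left_diff_distrib diff_divide_distrib)
      ultimately have "\<bar>v i x - v i y\<bar> * (real l / S) \<le> 1" using S by (simp add: abs_mult)
      thus ?thesis unfolding eq using S l by (simp add: field_simps)
    qed
  qed
qed

text \<open>The first L Taylor coefficients of the combination are made small; being complex, they
  count as 2 L real forms. The terms from L on are controlled by the Cauchy estimates on the larger
  disc, which lose a geometric factor r / r1 in each degree.\<close>

lemma small_combination:
  fixes \<phi> :: "'j \<Rightarrow> complex \<Rightarrow> complex" and u :: "'j \<Rightarrow> nat \<Rightarrow> complex"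
  assumes fin: "finite J" and r: "0 < r" "r < r1" and M: "M > 0" and l: "l \<ge> 1" and H: "H \<ge> 1"
    and J: "J \<noteq> {}"
    and expand: "\<And>j z. j \<in> J \<Longrightarrow> z \<in> cball 0 r \<Longrightarrow> (\<lambda>n. u j n * z ^ n) sums \<phi> j z"
    and ubound: "\<And>j n. j \<in> J \<Longrightarrow> cmod (u j n) \<le> M / r1 ^ n"
    and S: "S = real (card J) * real H * M"
    and count: "(2 * l + 1) ^ (2 * L) < (H + 1) ^ card J"
  shows "\<exists>x :: 'j \<Rightarrow> int. (\<exists>j\<in>J. x j \<noteq> 0) \<and> (\<forall>j\<in>J. \<bar>x j\<bar> \<le> int H) \<and>
    (\<forall>z\<in>cball 0 r. cmod (\<Sum>j\<in>J. of_int (x j) * \<phi> j z)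
        \<le> 2 * real L * (S / real l) + S * (r / r1) ^ L / (1 - r / r1))"
proof -
  define I where "I = {..<L} \<times> {True, False}"
  \<comment> \<open>The flag tells real from imaginary part, and the weight r^n makes each form
    measure the size of its term on the disc of radius r.\<close>
  define w where "w = (\<lambda>(n, b) j. (if b then Re (u j n) else Im (u j n)) * r ^ n)"
  have S0: "S > 0" using S M H J fin by (simp add: card_gt_0_iff)
  have cardI: "card I = 2 * L" by (simp add: I_def card_cartesian_product)
  have un: "cmod (u j n) * r ^ n \<le> M * (r / r1) ^ n" if "j \<in> J" for j n
    using mult_right_mono[OF ubound[OF that, of n], of "r ^ n"] r by (simp add: power_divide)
  have w_bound: "(\<Sum>j\<in>J. \<bar>w i j\<bar>) * real H \<le> S" if "i \<in> I" for i
  proof -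
    obtain n b where i: "i = (n, b)" by (cases i)
    have "\<bar>w i j\<bar> \<le> M" if "j \<in> J" for j
    proof -
      have "\<bar>w i j\<bar> \<le> cmod (u j n) * r ^ n"
        using r abs_Re_le_cmod[of "u j n"] abs_Im_le_cmod[of "u j n"]
        by (auto simp: w_def i abs_mult intro!: mult_right_mono)
      also have "\<dots> \<le> M * (r / r1) ^ n" by (rule un[OF that])
      also have "\<dots> \<le> M * 1" using r M by (intro mult_left_mono power_le_one) auto
      finally show ?thesis by simp
    qed
    hence "(\<Sum>j\<in>J. \<bar>w i j\<bar>) \<le> real (card J) * M" by (intro sum_bounded_above[THEN order.trans]) auto
    from mult_right_mono[OF this, of "real H"] show ?thesis by (simp add: S mult_ac)
  qed
  obtain x where x: "\<exists>j\<in>J. x j \<noteq> 0" "\<And>j. j \<in> J \<Longrightarrow> \<bar>x j\<bar> \<le> int H"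
    and small: "\<And>i. i \<in> I \<Longrightarrow> \<bar>\<Sum>j\<in>J. w i j * real_of_int (x j)\<bar> \<le> S / real l"
    using pigeonhole_small_forms[of I J S l w H] fin S0 l w_bound count
    unfolding cardI by (auto simp: I_def)
  define c where "c = (\<lambda>n. \<Sum>j\<in>J. of_int (x j) * u j n)"
  have c_small: "cmod (c n) * r ^ n \<le> 2 * (S / real l)" if "n < L" for n
  proof -
    have part: "\<bar>(if b then Re (c n) else Im (c n))\<bar> * r ^ n \<le> S / real l" for b
    proof -
      have "(if b then Re (c n) else Im (c n)) * r ^ n = (\<Sum>j\<in>J. w (n, b) j * real_of_int (x j))"
        unfolding c_def w_def by (cases b) (auto simp: sum_distrib_right intro!: sum.cong)
      hence "\<bar>(if b then Re (c n) else Im (c n)) * r ^ n\<bar> \<le> S / real l"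
        using small[of "(n, b)"] that by (simp add: I_def)
      thus ?thesis using r by (simp add: abs_mult)
    qed
    have "cmod (c n) * r ^ n \<le> (\<bar>Re (c n)\<bar> + \<bar>Im (c n)\<bar>) * r ^ n"
      using r by (intro mult_right_mono cmod_le) auto
    thus ?thesis using part[of True] part[of False] by (simp add: distrib_right)
  qed
  have c_bound: "cmod (c n) * r ^ n \<le> S * (r / r1) ^ n" for n
  proof -
    have "cmod (c n) * r ^ n \<le> (\<Sum>j\<in>J. cmod (of_int (x j) * u j n)) * r ^ n"
      unfolding c_def using r by (intro mult_right_mono norm_sum) auto
    also have "\<dots> = (\<Sum>j\<in>J. \<bar>real_of_int (x j)\<bar> * (cmod (u j n) * r ^ n))"
      by (simp only: norm_mult norm_of_int sum_distrib_right mult.assoc)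
    also have "\<dots> \<le> (\<Sum>j\<in>J. real H * (M * (r / r1) ^ n))"
    proof (rule sum_mono)
      fix j assume j: "j \<in> J"
      hence "\<bar>real_of_int (x j)\<bar> \<le> real H" using x(2)[of j] by linarith
      thus "\<bar>real_of_int (x j)\<bar> * (cmod (u j n) * r ^ n) \<le> real H * (M * (r / r1) ^ n)"
        using r by (intro mult_mono[OF _ un[OF j]]) auto
    qed
    also have "\<dots> = S * (r / r1) ^ n" by (simp add: S)
    finally show ?thesis .
  qed
  show ?thesis
  proof (intro exI[of _ x] conjI ballI x)
    fix z :: complex assume z: "z \<in> cball 0 r"
    define F where "F = (\<Sum>j\<in>J. of_int (x j) * \<phi> j z)"
    have "(\<lambda>n. \<Sum>j\<in>J. of_int (x j) * (u j n * z ^ n)) sums F"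
      unfolding F_def using expand z by (intro sums_sum sums_mult) auto
    moreover have "(\<lambda>n. \<Sum>j\<in>J. of_int (x j) * (u j n * z ^ n)) = (\<lambda>n. c n * z ^ n)"
      by (rule ext) (simp only: c_def sum_distrib_right mult.assoc)
    ultimately have F: "(\<lambda>n. c n * z ^ n) sums F" by simp
    have zr: "cmod z ^ n \<le> r ^ n" for n using z by (intro power_mono) auto
    have term_le: "cmod (c n * z ^ n) \<le> cmod (c n) * r ^ n" for n
      using zr[of n] by (simp add: norm_mult norm_power mult_left_mono)
    have ratio: "r / r1 < 1" "0 \<le> r / r1" using r by auto
    have geo: "(\<lambda>n. S * (r / r1) ^ (n + L)) sums (S * (r / r1) ^ L / (1 - r / r1))"
      using sums_mult[OF geometric_sums[of "r / r1"], of "S * (r / r1) ^ L"] ratio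
      by (simp add: power_add mult_ac)
    have tail: "cmod (\<Sum>n. c (n + L) * z ^ (n + L)) \<le> S * (r / r1) ^ L / (1 - r / r1)"
    proof -
      have "cmod (\<Sum>n. c (n + L) * z ^ (n + L)) \<le> (\<Sum>n. S * (r / r1) ^ (n + L))"
      proof (rule norm_suminf_le)
        show "cmod (c (n + L) * z ^ (n + L)) \<le> S * (r / r1) ^ (n + L)" for n
          using term_le c_bound by (rule order.trans)
        show "summable (\<lambda>n. S * (r / r1) ^ (n + L))" using geo by (rule sums_summable)
      qed
      thus ?thesis using sums_unique[OF geo] by simp
    qed
    have "F = (\<Sum>n. c (n + L) * z ^ (n + L)) + (\<Sum>n<L. c n * z ^ n)"
      using F suminf_split_initial_segment[of "\<lambda>n. c n * z ^ n" L] by (simp add: sums_iff)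
    hence "cmod F \<le> cmod (\<Sum>n. c (n + L) * z ^ (n + L)) + cmod (\<Sum>n<L. c n * z ^ n)"
      by (simp add: norm_triangle_ineq)
    also have "cmod (\<Sum>n<L. c n * z ^ n) \<le> (\<Sum>n<L. 2 * (S / real l))"
      using c_small by (intro sum_norm_le order.trans[OF term_le]) auto
    finally show "cmod (\<Sum>j\<in>J. of_int (x j) * \<phi> j z)
        \<le> 2 * real L * (S / real l) + S * (r / r1) ^ L / (1 - r / r1)"
      using tail unfolding F_def[symmetric] by (simp add: mult_ac)
  qed
qed

section \<open>The Schwarz lemma with many zeros\<close>

lemma blaschke_factor_le:
  assumes r: "0 < r" "r < r1" and z: "cmod z \<le> r" and a: "cmod a \<le> r"
  shows "cmod (of_real r1 * (z - a)) \<le> 2 * r * r1 / (r1\<^sup>2 + r\<^sup>2) * cmod (of_real (r1\<^sup>2) - cnj a * z)"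
proof -
  define B where "B = cmod (of_real (r1\<^sup>2) - cnj a * z)"
  have r1: "r1 > 0" using r by simp
  \<comment> \<open>The identity for 1 - |Blaschke factor|^2 with denominators cleared. The bound on
    B that follows is attained for z = -a with |a| = r, and this extremal case is the origin of the
    constant.\<close>
  have id: "B\<^sup>2 - (cmod (of_real r1 * (z - a)))\<^sup>2 = (r1\<^sup>2 - (cmod z)\<^sup>2) * (r1\<^sup>2 - (cmod a)\<^sup>2)"
    unfolding B_def cmod_power2 by (simp add: power2_eq_square algebra_simps)
  have B_le: "B \<le> r1\<^sup>2 + r\<^sup>2"
  proof -
    have "B \<le> cmod (of_real (r1\<^sup>2)) + cmod (cnj a * z)" unfolding B_def by (rule norm_triangle_ineq4)
    also have "\<dots> \<le> r1\<^sup>2 + r * r"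
      using z a r by (intro add_mono) (auto simp: norm_mult norm_power intro!: mult_mono)
    finally show ?thesis by (simp add: power2_eq_square)
  qed
  have B0: "B \<ge> 0" by (simp add: B_def)
  define k where "k = 2 * r * r1 / (r1\<^sup>2 + r\<^sup>2)"
  have den: "r1\<^sup>2 + r\<^sup>2 > 0" using r1 by (simp add: add_pos_nonneg)
  have k2: "k\<^sup>2 = 1 - (r1\<^sup>2 - r\<^sup>2)\<^sup>2 / (r1\<^sup>2 + r\<^sup>2)\<^sup>2"
  proof -
    have "k\<^sup>2 = (2 * r * r1)\<^sup>2 / (r1\<^sup>2 + r\<^sup>2)\<^sup>2" unfolding k_def by (simp only: power_divide)
    also have "(2 * r * r1)\<^sup>2 = (r1\<^sup>2 + r\<^sup>2)\<^sup>2 - (r1\<^sup>2 - r\<^sup>2)\<^sup>2"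
      by (simp add: power2_eq_square algebra_simps)
    finally show ?thesis using den r1 by (simp add: diff_divide_distrib)
  qed
  have "(r1\<^sup>2 - r\<^sup>2)\<^sup>2 / (r1\<^sup>2 + r\<^sup>2)\<^sup>2 * B\<^sup>2 \<le> (r1\<^sup>2 - r\<^sup>2)\<^sup>2 / (r1\<^sup>2 + r\<^sup>2)\<^sup>2 * (r1\<^sup>2 + r\<^sup>2)\<^sup>2"
    using B_le B0 by (intro mult_left_mono power_mono) auto
  also have "\<dots> = (r1\<^sup>2 - r\<^sup>2) * (r1\<^sup>2 - r\<^sup>2)" using den by (simp add: power2_eq_square)
  also have "\<dots> \<le> (r1\<^sup>2 - (cmod z)\<^sup>2) * (r1\<^sup>2 - (cmod a)\<^sup>2)"
    using z a r by (intro mult_mono diff_left_mono power_mono) (auto intro!: power_mono)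
  finally have "(cmod (of_real r1 * (z - a)))\<^sup>2 \<le> k\<^sup>2 * B\<^sup>2"
    using id unfolding k2 by (simp add: left_diff_distrib)
  hence "(cmod (of_real r1 * (z - a)))\<^sup>2 \<le> (k * B)\<^sup>2" by (simp add: power_mult_distrib)
  moreover have "k * B \<ge> 0" using B0 r r1 by (simp add: k_def)
  ultimately show ?thesis unfolding B_def[symmetric] k_def[symmetric] by (rule power2_le_imp_le)
qed

text \<open>The Blaschke factor has modulus 1 on the circle, here written without a
  quotient.\<close>

lemma blaschke_factor_boundary:
  assumes "cmod z = r1"
  shows "cmod (of_real (r1\<^sup>2) - cnj a * z) = r1 * cmod (z - a)"
proof -
  have "of_real (r1\<^sup>2) = cnj z * z"
    using complex_norm_square[of z] assms by (simp add: mult.commute)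
  hence "of_real (r1\<^sup>2) - cnj a * z = cnj (z - a) * z" by (simp add: left_diff_distrib)
  thus ?thesis using assms by (simp add: norm_mult mult.commute del: complex_cnj_diff)
qed

text \<open>Dividing by a Blaschke factor keeps the bound M on the outer circle and gains 2 r r1 /
  (r1^2 + r^2) < 1 inside, for every r < r1. Division by z - a would give 2 r / (r1 - r), which
  helps only if r1 > 3 r.\<close>

lemma schwarz_zeros:
  assumes r: "0 < r" "r < r1" and U: "open U" "cball 0 r1 \<subseteq> U" and hol: "G holomorphic_on U"
    and bound: "\<And>z. cmod z = r1 \<Longrightarrow> cmod (G z) \<le> M"
    and S: "finite S" "S \<subseteq> cball 0 r" "\<And>a. a \<in> S \<Longrightarrow> G a = 0"
    and z: "z \<in> cball 0 r"
  shows "cmod (G z) \<le> M * (2 * r * r1 / (r1\<^sup>2 + r\<^sup>2)) ^ card S"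
  using S(1) hol bound S(2,3) z
proof (induction S arbitrary: G z rule: finite_induct)
  case empty
  have "cmod (G z) \<le> M"
  proof (rule maximum_modulus_frontier[of G "cball 0 r1"])
    show "G holomorphic_on interior (cball 0 r1)"
      using empty.prems(1) U by (meson holomorphic_on_subset interior_subset order.trans)
    show "continuous_on (closure (cball 0 r1)) G"
      using continuous_on_subset[OF holomorphic_on_imp_continuous_on[OF empty.prems(1)] U(2)] by simp
    show "cmod (G w) \<le> M" if "w \<in> frontier (cball 0 r1)" for w
      using that empty.prems(2) r by auto
    show "z \<in> cball 0 r1" using empty.prems(5) r by auto
  qed auto
  thus ?case by simp
next
  case (insert a S)
  define \<kappa> where "\<kappa> = 2 * r * r1 / (r1\<^sup>2 + r\<^sup>2)"
  have a: "cmod a \<le> r" "G a = 0" using insert.prems by auto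
  \<comment> \<open>The value at a removes the singularity. The remaining zeros differ from a, S
    being a set, so they remain zeros of q.\<close>
  define q where "q = (\<lambda>w. if w = a then deriv G a else (G w - G a) / (w - a))"
  define G1 where "G1 = (\<lambda>w. q w * (of_real (r1\<^sup>2) - cnj a * w) / of_real r1)"
  have q: "q holomorphic_on U" unfolding q_def by (rule pole_lemma_open[OF insert.prems(1) U(1)])
  have G1: "G1 holomorphic_on U" unfolding G1_def using r by (intro holomorphic_intros q) auto
  have Gq: "G w = q w * (w - a)" for w using a by (simp add: q_def)
  have bound1: "cmod (G1 w) \<le> M" if w: "cmod w = r1" for w
  proof -
    have "cmod (G1 w) = cmod (q w) * cmod (w - a)"
      using r blaschke_factor_boundary[OF w, of a] by (simp add: G1_def norm_mult norm_divide)
    thus ?thesis using insert.prems(2)[OF w] by (simp add: Gq norm_mult)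
  qed
  have zeros: "G1 b = 0" if "b \<in> S" for b
  proof -
    have "b \<noteq> a" "G b = 0" using that insert by auto
    thus ?thesis by (simp add: G1_def q_def a)
  qed
  have IH: "cmod (G1 z) \<le> M * \<kappa> ^ card S" unfolding \<kappa>_def
    by (rule insert.IH[OF G1 bound1 _ zeros insert.prems(5)]) (use insert.prems in auto)
  have \<kappa>: "\<kappa> \<ge> 0" using r by (simp add: \<kappa>_def)
  have "cmod (G z) * r1 = cmod (q z) * cmod (of_real r1 * (z - a))"
    using r by (simp add: Gq norm_mult)
  also have "\<dots> \<le> cmod (q z) * (\<kappa> * cmod (of_real (r1\<^sup>2) - cnj a * z))"
    unfolding \<kappa>_def using insert.prems(5) by (intro mult_left_mono blaschke_factor_le r a) auto
  also have "\<dots> = \<kappa> * cmod (G1 z) * r1" using r by (simp add: G1_def norm_mult norm_divide)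
  also have "\<dots> \<le> \<kappa> * (M * \<kappa> ^ card S) * r1"
    using IH \<kappa> r by (intro mult_right_mono mult_left_mono) auto
  finally have "cmod (G z) \<le> \<kappa> * (M * \<kappa> ^ card S)" using r by simp
  thus ?case using insert(1,2) by (simp add: \<kappa>_def mult_ac)
qed

section \<open>The auxiliary function\<close>

lemma eval2_add: "eval2 (P + Q) x y = eval2 P x y + eval2 Q x y"
proof -
  have "map_poly (\<lambda>c. poly c x) (P + Q) = map_poly (\<lambda>c. poly c x) P + map_poly (\<lambda>c. poly c x) Q"
    by (rule poly_eqI) (simp add: coeff_map_poly)
  thus ?thesis by (simp add: eval2_def)
qed

lemma eval2_sum: "eval2 (sum P I) x y = (\<Sum>i\<in>I. eval2 (P i) x y)"
proof (induction I rule: infinite_finite_induct)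
  case (insert i I)
  thus ?case by (simp add: eval2_add)
qed (simp_all add: eval2_def)

lemma eval2_monom: "eval2 (monom (monom c k) l) x y = c * x ^ k * y ^ l"
  by (simp add: eval2_def map_poly_monom poly_monom)

lemma transcendental_imp_coeffs_0:
  assumes "transcendental_on A f"
    and "\<And>z. z \<in> A \<Longrightarrow> (\<Sum>k<T. \<Sum>l<T. c k l * z ^ k * f z ^ l) = 0"
    and kl: "k < T" "l < (T::nat)"
  shows "c k l = 0"
proof -
  define P where "P = (\<Sum>k<T. \<Sum>l<T. monom (monom (c k l) k) l)"
  have "\<forall>z\<in>A. eval2 P z (f z) = 0" using assms(2) by (simp add: P_def eval2_sum eval2_monom)
  hence "P = 0" using assms(1) unfolding transcendental_on_def by blast
  have "coeff P l = (\<Sum>i<T. \<Sum>j<T. if j = l then monom (c i j) i else 0)"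
    unfolding P_def by (simp add: coeff_sum)
  also have "\<dots> = (\<Sum>i<T. monom (c i l) i)" using kl by simp
  finally have "coeff (coeff P l) k = c k l" using kl by (simp add: coeff_sum)
  thus ?thesis unfolding \<open>P = 0\<close> by simp
qed

section \<open>Estimates by powers of two and the choice of P\<close>

lemma exp_le_power2: "x \<le> real n \<Longrightarrow> exp x \<le> 2 ^ (2 * n)"
proof -
  assume "x \<le> real n"
  hence "exp x \<le> exp (real n * 1)" by simp
  also have "\<dots> = exp 1 ^ n" by (rule exp_of_nat_mult)
  also have "\<dots> \<le> 4 ^ n" using exp_le by (intro power_mono) auto
  also have "(4::real) ^ n = 2 ^ (2 * n)" by (simp add: power_mult)
  finally show ?thesis .
qed

lemma square_le_power2: "real T ^ 2 \<le> 2 ^ (2 * T)"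
proof -
  have "real T \<le> 2 ^ T" using of_nat_less_two_power[of T, where 'a = real] by simp
  hence "real T ^ 2 \<le> (2 ^ T) ^ 2" by (intro power_mono) auto
  also have "\<dots> = 2 ^ (2 * T)" by (simp only: power_mult[symmetric] mult.commute)
  finally show ?thesis .
qed

text \<open>7 = 2 + 1 + 4: the number of terms gives 2^(2 T), the coefficients 2^(T n), the two
  heights exp(2 T n) \<le> 2^(4 T n). The exponent w is kept apart from T n because later the
  coefficients stay at 2^(T N) while n grows.\<close>

lemma liouville_Sigma:
  assumes \<alpha>: "\<alpha> \<in> Sigma_alg D (real n) f r"
    and T: "T \<ge> 1" and n: "n \<ge> 1" and w: "w \<le> T * n"
    and p: "\<And>k l. k < T \<Longrightarrow> l < T \<Longrightarrow> \<bar>p k l\<bar> \<le> 2 ^ w"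
    and ne: "(\<Sum>k<T. \<Sum>l<T. of_int (p k l) * \<alpha> ^ k * f \<alpha> ^ l) \<noteq> 0"
  shows "1 \<le> cmod (\<Sum>k<T. \<Sum>l<T. of_int (p k l) * \<alpha> ^ k * f \<alpha> ^ l) * 2 ^ (7 * (D * T * n))"
proof -
  let ?x = "\<Sum>k<T. \<Sum>l<T. of_int (p k l) * \<alpha> ^ k * f \<alpha> ^ l"
  have alg: "algebraic \<alpha>" "algebraic (f \<alpha>)" and D: "degree_over_Q (Q_adjoin {\<alpha>, f \<alpha>}) \<le> D"
    and h: "abs_log_height \<alpha> \<le> real n" "abs_log_height (f \<alpha>) \<le> real n"
    using \<alpha> by (auto simp: Sigma_alg_def)
  let ?B = "real T ^ 2 * 2 ^ w * exp (real T * (abs_log_height \<alpha> + abs_log_height (f \<alpha>)))"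
  have p': "\<bar>real_of_int (p k l)\<bar> \<le> 2 ^ w" if "k < T" "l < T" for k l
  proof -
    have "real_of_int \<bar>p k l\<bar> \<le> real_of_int (2 ^ w)" using p[OF that] by (simp only: of_int_le_iff)
    thus ?thesis by simp
  qed
  have "?B \<le> 2 ^ (2 * T) * 2 ^ (T * n) * 2 ^ (2 * (2 * T * n))"
  proof (intro mult_mono square_le_power2 exp_le_power2 power_increasing w)
    have "real T * (abs_log_height \<alpha> + abs_log_height (f \<alpha>)) \<le> real T * (real n + real n)"
      using h by (intro mult_left_mono add_mono) auto
    thus "real T * (abs_log_height \<alpha> + abs_log_height (f \<alpha>)) \<le> real (2 * T * n)"
      by (simp add: algebra_simps)
  qed auto
  also have "\<dots> = 2 ^ (2 * T + 5 * (T * n))" by (simp flip: power_add)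
  also have "\<dots> \<le> (2::real) ^ (7 * (T * n))" using n by (intro power_increasing) auto
  finally have B: "?B \<le> 2 ^ (7 * (T * n))" .
  have "1 \<le> cmod ?x * ?B ^ D"
    by (rule liouville[OF alg D T _ p' refl ne]) simp
  also have "\<dots> \<le> cmod ?x * (2 ^ (7 * (T * n))) ^ D"
    by (intro mult_left_mono power_mono B) auto
  also have "((2::real) ^ (7 * (T * n))) ^ D = 2 ^ (7 * (D * T * n))"
    by (simp add: power_mult[symmetric] mult_ac)
  finally show ?thesis .
qed

text \<open>The integer s absorbs the geometry: s factors r / r1 are worth 1/2, and 2^s bounds the
  geometric series. All other exponents are measured in units of E = D T N.\<close>

lemma auxiliary_function:
  fixes f :: "complex \<Rightarrow> complex"
  assumes r: "0 < r" "r < r1" and f: "f holomorphic_on U" "open U" "cball 0 r1 \<subseteq> U"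
    and b: "\<forall>z\<in>cball 0 r1. cmod z \<le> 2 ^ b \<and> cmod (f z) \<le> 2 ^ b"
    and s: "s \<ge> 1" "(r / r1) ^ s \<le> 1 / 2" "1 / (1 - r / r1) \<le> 2 ^ s"
    and D: "D \<ge> 1" and N: "N \<ge> 2 + 2 * b" "N \<ge> s + 2" "\<forall>E\<ge>N. 80 * s * E \<le> 2 ^ E"
    and T: "T = 240 * s * D ^ 2 * N"
  shows "\<exists>p :: nat \<Rightarrow> nat \<Rightarrow> int. (\<exists>k<T. \<exists>l<T. p k l \<noteq> 0) \<and>
    (\<forall>k<T. \<forall>l<T. \<bar>p k l\<bar> \<le> 2 ^ (T * N)) \<and>
    (\<forall>z\<in>cball 0 r. cmod (\<Sum>k<T. \<Sum>l<T. of_int (p k l) * z ^ k * f z ^ l) * 2 ^ (7 * (D * T * N)) < 1) \<and>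
    (\<forall>z\<in>cball 0 r1. cmod (\<Sum>k<T. \<Sum>l<T. of_int (p k l) * z ^ k * f z ^ l) \<le> 2 ^ (2 * (T * N)))"
proof -
  define E where "E = D * T * N"
  have N1: "N \<ge> 1" using N(1) by simp
  have T1: "T \<ge> 1" using T s D N1 by simp
  have TNE: "T * N \<le> E" using D by (simp add: E_def)
  have NE: "N \<le> E" using mult_le_mono1[OF T1, of N] TNE by linarith
  have E1: "E \<ge> 1" using NE N1 by simp
  define J where "J = {..<T} \<times> {..<T}"
  define \<phi> where "\<phi> = (\<lambda>(k,l) z. z ^ k * f z ^ l)"
  define u where "u = (\<lambda>j n. (deriv ^^ n) (\<phi> j) 0 / fact n)"
  define M :: real where "M = 2 ^ (2 * (T * b))"
  define H :: nat where "H = 2 ^ (T * N)"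
  \<comment> \<open>This L gives (r / r1)^L \<le> 2^(-10 E), matching boxes of relative size 2^(-10
    E). As S \<le> 2^(2 E), both errors are 2^(-8 E) up to factors 2 L and 2^s, for which one more
    2^E is available before 2^(-7 E) is reached.\<close>
  define L where "L = s * (10 * E)"
  define S where "S = real (card J) * real H * M"
  have cardJ: "card J = T * T" by (simp add: J_def card_cartesian_product)
  have b1: "(2::real) ^ b \<ge> 1" by simp
  have \<phi>_hol: "\<phi> j holomorphic_on U" for j
    unfolding \<phi>_def case_prod_unfold by (intro holomorphic_intros f)
  have \<phi>_bound: "cmod (\<phi> j z) \<le> M" if jJ: "j \<in> J" and z: "z \<in> cball 0 r1" for j z
  proof -
    obtain k l where j: "j = (k, l)" "k < T" "l < T" using jJ by (auto simp: J_def)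
    have pw: "cmod y ^ i \<le> (2 ^ b) ^ T" if "cmod y \<le> 2 ^ b" "i < T" for y :: complex and i
    proof -
      have "cmod y ^ i \<le> (2 ^ b) ^ i" using that by (intro power_mono) auto
      also have "\<dots> \<le> (2 ^ b) ^ T" using that by (intro power_increasing) auto
      finally show ?thesis .
    qed
    have "cmod (\<phi> j z) = cmod z ^ k * cmod (f z) ^ l" by (simp add: j \<phi>_def norm_mult norm_power)
    also have "\<dots> \<le> (2 ^ b) ^ T * (2 ^ b) ^ T"
      using bspec[OF b z] j by (intro mult_mono pw) auto
    also have "\<dots> = M" by (simp add: M_def power_mult[symmetric] power_add[symmetric] mult_2 mult.commute)
    finally show ?thesis .
  qed
  have r1: "r1 > 0" using r by simp
  have ubound: "cmod (u j n) \<le> M / r1 ^ n" if "j \<in> J" for j n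
  proof -
    have "cmod ((deriv ^^ n) (\<phi> j) 0) \<le> fact n * M / r1 ^ n"
    proof (rule Cauchy_inequality)
      show "\<phi> j holomorphic_on ball 0 r1"
        using \<phi>_hol f(3) by (meson ball_subset_cball holomorphic_on_subset order.trans)
      show "continuous_on (cball 0 r1) (\<phi> j)"
        using \<phi>_hol f(3) by (meson continuous_on_subset holomorphic_on_imp_continuous_on)
      show "cmod (\<phi> j x) \<le> M" if "cmod (0 - x) = r1" for x
        using \<phi>_bound[OF \<open>j \<in> J\<close>, of x] that by simp
    qed (rule r1)
    thus ?thesis by (simp add: u_def norm_divide field_simps)
  qed
  have expand: "(\<lambda>n. u j n * z ^ n) sums \<phi> j z" if "j \<in> J" "z \<in> cball 0 r" for j z
  proof -
    have "\<phi> j holomorphic_on ball 0 r1"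
      using \<phi>_hol f(3) by (meson ball_subset_cball holomorphic_on_subset order.trans)
    moreover have "z \<in> ball 0 r1" using that(2) r by simp
    ultimately show ?thesis using holomorphic_power_series[of "\<phi> j" 0 r1 z] by (simp add: u_def)
  qed
  have count: "(2 * 2 ^ (10 * E) + 1) ^ (2 * L) < (H + 1) ^ card J"
  proof -
    \<comment> \<open>The factor \<open>240\<close> in \<open>T\<close> is chosen so that \<open>12 E \<cdot> 2 L = 240 s E\<^sup>2 = T N \<cdot> T\<^sup>2\<close>.\<close>
    have "(2 * 2 ^ (10 * E) + 1) ^ (2 * L) \<le> ((2::nat) ^ (10 * E + 2)) ^ (2 * L)"
      by (intro power_mono) auto
    also have "\<dots> = (2::nat) ^ ((10 * E + 2) * (2 * L))" by (rule power_mult[symmetric])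
    also have "\<dots> \<le> 2 ^ (T * N * card J)"
    proof (rule power_increasing)
      have "(10 * E + 2) * (2 * L) \<le> (12 * E) * (2 * L)" using E1 by (intro mult_right_mono) auto
      also have "\<dots> = T * N * card J"
        by (simp add: L_def cardJ E_def T power2_eq_square algebra_simps)
      finally show "(10 * E + 2) * (2 * L) \<le> T * N * card J" .
    qed simp
    also have "\<dots> = H ^ card J" by (simp add: H_def power_mult)
    also have "\<dots> < (H + 1) ^ card J" using T1 by (intro power_strict_mono) (auto simp: cardJ)
    finally show ?thesis .
  qed
  have S_le: "S \<le> 2 ^ (2 * (T * N))"
  proof -
    have "S = real T ^ 2 * 2 ^ (T * N) * 2 ^ (2 * (T * b))"
      by (simp add: S_def cardJ H_def M_def power2_eq_square)
    also have "\<dots> \<le> 2 ^ (2 * T) * 2 ^ (T * N) * 2 ^ (2 * (T * b))"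
      by (intro mult_right_mono square_le_power2) auto
    also have "\<dots> = 2 ^ (T * (2 + 2 * b) + T * N)" by (simp add: algebra_simps flip: power_add)
    \<comment> \<open>N \<ge> 2 + 2 b lets one factor 2^(T N) absorb both the number of terms and
      the size of the monomials z^k f(z)^l.\<close>
    also have "\<dots> \<le> 2 ^ (T * N + T * N)"
      using N(1) by (intro power_increasing add_right_mono mult_left_mono) auto
    finally show ?thesis by (simp add: mult_2)
  qed
  have S0: "S \<ge> 0" by (simp add: S_def M_def)
  have J0: "finite J" "J \<noteq> {}"
  proof -
    show "finite J" by (simp add: J_def)
    have "card J \<noteq> 0" using T1 cardJ by simp
    thus "J \<noteq> {}" by (rule contrapos_nn) simp
  qed
  have M0: "M > 0" by (simp add: M_def)
  have l1: "(1::nat) \<le> 2 ^ (10 * E)" and H1: "1 \<le> H" by (simp_all add: H_def)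
  have "\<exists>x :: nat \<times> nat \<Rightarrow> int. (\<exists>j\<in>J. x j \<noteq> 0) \<and> (\<forall>j\<in>J. \<bar>x j\<bar> \<le> int H) \<and>
      (\<forall>z\<in>cball 0 r. cmod (\<Sum>j\<in>J. of_int (x j) * \<phi> j z)
        \<le> 2 * real L * (S / real (2 ^ (10 * E))) + S * (r / r1) ^ L / (1 - r / r1))"
    by (rule small_combination[OF J0(1) r M0 l1 H1 J0(2) expand ubound S_def count])
  then obtain x :: "nat \<times> nat \<Rightarrow> int" where x1: "\<exists>j\<in>J. x j \<noteq> 0" and x2: "\<forall>j\<in>J. \<bar>x j\<bar> \<le> int H"
    and x3: "\<forall>z\<in>cball 0 r. cmod (\<Sum>j\<in>J. of_int (x j) * \<phi> j z)
        \<le> 2 * real L * (S / real (2 ^ (10 * E))) + S * (r / r1) ^ L / (1 - r / r1)"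
    by (elim exE conjE)
  define p where "p = (\<lambda>k l. x (k, l))"
  have F: "(\<Sum>k<T. \<Sum>l<T. of_int (p k l) * z ^ k * f z ^ l) = (\<Sum>j\<in>J. of_int (x j) * \<phi> j z)" for z
    by (simp add: p_def J_def \<phi>_def sum.cartesian_product case_prod_unfold mult.assoc)
  show ?thesis
  proof (intro exI[of _ p] conjI ballI allI impI)
    show "\<exists>k<T. \<exists>l<T. p k l \<noteq> 0" using x1 by (auto simp: J_def p_def)
    fix k l assume "k < T" "l < T"
    thus "\<bar>p k l\<bar> \<le> 2 ^ (T * N)"
      using bspec[OF x2, of "(k, l)"] by (simp add: J_def p_def H_def)
  next
    fix z :: complex assume z: "z \<in> cball 0 r1"
    have "cmod (\<Sum>j\<in>J. of_int (x j) * \<phi> j z) \<le> (\<Sum>j\<in>J. real H * M)"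
    proof (rule sum_norm_le)
      fix j assume j: "j \<in> J"
      have "cmod (of_int (x j) * \<phi> j z) = \<bar>real_of_int (x j)\<bar> * cmod (\<phi> j z)" by (simp add: norm_mult)
      also have "\<dots> \<le> real H * M"
        using bspec[OF x2 j] \<phi>_bound[OF j z] by (intro mult_mono) auto
      finally show "cmod (of_int (x j) * \<phi> j z) \<le> real H * M" .
    qed
    also have "\<dots> = S" by (simp add: S_def)
    finally show "cmod (\<Sum>k<T. \<Sum>l<T. of_int (p k l) * z ^ k * f z ^ l) \<le> 2 ^ (2 * (T * N))"
      using S_le unfolding F by linarith
  next
    fix z :: complex assume z: "z \<in> cball 0 r"
    define e :: real where "e = S / 2 ^ (10 * E)"
    have e0: "e \<ge> 0" using S0 by (simp add: e_def)
    have "S \<le> 2 ^ (2 * E)" using S_le TNE by (meson order.trans power_increasing mult_le_mono2 one_le_numeral)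
    hence "e \<le> 2 ^ (2 * E) / 2 ^ (10 * E)" unfolding e_def by (intro divide_right_mono) auto
    also have "(2::real) ^ (10 * E) = 2 ^ (2 * E) * 2 ^ (8 * E)" by (simp flip: power_add)
    finally have e: "e \<le> 1 / 2 ^ (8 * E)" by simp
    have "(r / r1) ^ L = ((r / r1) ^ s) ^ (10 * E)" unfolding L_def by (rule power_mult)
    also have "\<dots> \<le> (1 / 2) ^ (10 * E)" using s(2) r by (intro power_mono) auto
    finally have "S * (r / r1) ^ L \<le> S * (1 / 2) ^ (10 * E)" using S0 by (rule mult_left_mono)
    also have "\<dots> = e" by (simp add: e_def power_one_over)
    finally have "S * (r / r1) ^ L \<le> e" .
    hence "S * (r / r1) ^ L * (1 / (1 - r / r1)) \<le> e * 2 ^ s"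
      using s(3) r e0 S0 by (intro mult_mono) auto
    hence "cmod (\<Sum>j\<in>J. of_int (x j) * \<phi> j z) \<le> 2 * real L * e + e * 2 ^ s"
      using bspec[OF x3 z] by (simp add: e_def)
    also have "\<dots> = (2 * real L + 2 ^ s) * e" by (simp only: distrib_right mult.commute[of e])
    also have "\<dots> \<le> (2 * real L + 2 ^ s) * (1 / 2 ^ (8 * E))" using e by (intro mult_left_mono) auto
    also have "\<dots> < 2 ^ E * (1 / 2 ^ (8 * E))"
    proof (rule mult_strict_right_mono)
      \<comment> \<open>Since 2 L = 20 s E, each of 2 L and 2^s takes at most a quarter of
        2^E.\<close>
      have "real (80 * s * E) \<le> real (2 ^ E)" using N(3)[rule_format, OF NE] by (simp only: of_nat_le_iff)
      hence "2 * real L \<le> 2 ^ E / 4" by (simp add: L_def)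
      moreover have "(2::real) ^ (s + 2) \<le> 2 ^ E" using N(2) NE by (intro power_increasing) auto
      hence "(2::real) ^ s \<le> 2 ^ E / 4" by simp
      moreover have "(2::real) ^ E > 0" by simp
      ultimately show "2 * real L + 2 ^ s < 2 ^ E" by linarith
    qed simp
    finally have "cmod (\<Sum>j\<in>J. of_int (x j) * \<phi> j z) * 2 ^ (7 * E) < 2 ^ E * (1 / 2 ^ (8 * E)) * 2 ^ (7 * E)"
      by (rule mult_strict_right_mono) simp
    also have "(2::real) ^ (8 * E) = 2 ^ E * 2 ^ (7 * E)" by (simp flip: power_add)
    finally show "cmod (\<Sum>k<T. \<Sum>l<T. of_int (p k l) * z ^ k * f z ^ l) * 2 ^ (7 * (D * T * N)) < 1"
      unfolding F E_def[symmetric] by simp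
  qed
qed

section \<open>Propagation of zeros and the contradiction\<close>

lemma eventually_linear_le_power2:
  obtains E0 :: nat where "\<And>E. E \<ge> E0 \<Longrightarrow> c * E \<le> 2 ^ E"
proof (rule that)
  fix E :: nat assume E: "2 * c + 2 \<le> E"
  have *: "c * (2 * c + 2 + n) \<le> 2 ^ (2 * c + 2 + n)" for n
  proof (induction n)
    case 0
    have "c + 1 \<le> 2 ^ c" using less_exp[of c] by (simp add: Suc_le_eq)
    hence "2 * (c + 1) \<le> 2 * 2 ^ c" by (rule mult_le_mono2)
    hence le: "2 * (c + 1) \<le> 2 ^ (c + 1)" by simp
    have "c * (2 * c + 2) \<le> (2 * (c + 1)) * (2 * (c + 1))" by (rule mult_le_mono) simp_all
    also have "\<dots> \<le> 2 ^ (c + 1) * 2 ^ (c + 1)" by (rule mult_le_mono[OF le le])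
    also have "\<dots> = 2 ^ ((c + 1) + (c + 1))" by (rule power_add[symmetric])
    also have "(c + 1) + (c + 1) = 2 * c + 2" by simp
    finally show ?case by (simp only: add_0_right)
  next
    case (Suc n)
    have "c \<le> 2 ^ (2 * c + 2 + n)"
      using less_exp[of c] power_increasing[of c "2 * c + 2 + n" "2::nat"] by linarith
    thus ?case using Suc by simp
  qed
  obtain n where "E = 2 * c + 2 + n" using E le_Suc_ex by blast
  thus "c * E \<le> 2 ^ E" using * by (simp only:)
qed

text \<open>\<open>card\<close> is 0 on infinite sets, so the infinite case is carried along as an
  alternative of its own.\<close>

lemma ex_finite_subset_card:
  assumes "infinite A \<or> card A \<ge> K"
  obtains S where "S \<subseteq> A" "finite S" "card S = K"
proof (cases "infinite A")
  case True
  from infinite_arbitrarily_large[OF this, of K] show ?thesis using that by blast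
next
  case False
  hence "K \<le> card A" using assms by blast
  from obtain_subset_with_card_n[OF this] show ?thesis using that by blast
qed

text \<open>E = D T (n + 1) belongs to the new level, while P and its bounds keep the old N. A block
  of t zeros gains 1/2, so 10 E blocks turn 2^(2 E) into 2^(-8 E), less than the 2^(-7 E) that a
  nonzero value at level n + 1 must reach.\<close>

lemma zero_propagation:
  fixes f :: "complex \<Rightarrow> complex" and p :: "nat \<Rightarrow> nat \<Rightarrow> int" and T :: nat
  defines "F \<equiv> \<lambda>z. \<Sum>k<T. \<Sum>l<T. of_int (p k l) * z ^ k * f z ^ l"
  assumes r: "0 < r" "r < r1" and f: "f holomorphic_on U" "open U" "cball 0 r1 \<subseteq> U"
    and t: "(2 * r * r1 / (r1\<^sup>2 + r\<^sup>2)) ^ t \<le> 1 / 2"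
    and D: "D \<ge> 1" and T: "T \<ge> 1" and N: "N \<ge> 1" "N \<le> n"
    and p: "\<And>k l. k < T \<Longrightarrow> l < T \<Longrightarrow> \<bar>p k l\<bar> \<le> 2 ^ (T * N)"
    and bound: "\<And>z. z \<in> cball 0 r1 \<Longrightarrow> cmod (F z) \<le> 2 ^ (2 * (T * N))"
    and S: "finite S" "S \<subseteq> cball 0 r" "\<And>\<alpha>. \<alpha> \<in> S \<Longrightarrow> F \<alpha> = 0"
      "card S = t * (10 * (D * T * (n + 1)))"
    and \<alpha>: "\<alpha> \<in> Sigma_alg D (real (n + 1)) f r"
  shows "F \<alpha> = 0"
proof (rule ccontr)
  assume ne: "F \<alpha> \<noteq> 0"
  define E where "E = D * T * (n + 1)"
  define \<kappa> where "\<kappa> = 2 * r * r1 / (r1\<^sup>2 + r\<^sup>2)"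
  have \<kappa>: "\<kappa> \<ge> 0" using r by (simp add: \<kappa>_def)
  have \<alpha>r: "\<alpha> \<in> cball 0 r" using \<alpha> by (simp add: Sigma_alg_def)
  have hol: "F holomorphic_on U" unfolding F_def by (intro holomorphic_intros f)
  have TNn: "T * N \<le> T * (n + 1)" using N by (intro mult_le_mono2) simp
  also have "\<dots> \<le> E" using mult_le_mono1[OF D, of "T * (n + 1)"] by (simp only: E_def mult_1 mult.assoc)
  finally have TNE: "T * N \<le> E" .
  have "cmod (F \<alpha>) \<le> 2 ^ (2 * (T * N)) * \<kappa> ^ card S" unfolding \<kappa>_def
    by (rule schwarz_zeros[OF r f(2,3) hol bound S(1-3) \<alpha>r]) simp
  also have "\<kappa> ^ card S = (\<kappa> ^ t) ^ (10 * E)" unfolding S(4) E_def by (rule power_mult)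
  also have "2 ^ (2 * (T * N)) * (\<kappa> ^ t) ^ (10 * E) \<le> 2 ^ (2 * E) * (1 / 2) ^ (10 * E)"
    using TNE t \<kappa> unfolding \<kappa>_def[symmetric] by (intro mult_mono power_increasing power_mono) auto
  also have "(2::real) ^ (2 * E) * (1 / 2) ^ (10 * E) = 1 / 2 ^ (8 * E)"
  proof -
    have "(2::real) ^ (10 * E) = 2 ^ (2 * E) * 2 ^ (8 * E)" by (simp flip: power_add)
    thus ?thesis by (simp add: power_one_over)
  qed
  finally have "cmod (F \<alpha>) * 2 ^ (7 * E) \<le> 1 / 2 ^ (8 * E) * 2 ^ (7 * E)"
    by (rule mult_right_mono) simp
  also have "(2::real) ^ (8 * E) = 2 ^ E * 2 ^ (7 * E)" by (simp flip: power_add)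
  finally have "cmod (F \<alpha>) * 2 ^ (7 * E) \<le> 1 / 2 ^ E" by simp
  moreover have "1 \<le> cmod (F \<alpha>) * 2 ^ (7 * E)"
    unfolding F_def E_def by (rule liouville_Sigma[OF \<alpha> T _ TNn p ne[unfolded F_def]]) simp
  moreover have "E \<ge> 1" using mult_le_mono[OF T N(1)] TNE by linarith
  hence "(2::real) ^ 1 \<le> 2 ^ E" by (intro power_increasing) auto
  hence "1 / 2 ^ E < (1::real)" by simp
  ultimately show False by linarith
qed

lemma ex_power_le_half:
  assumes "0 \<le> x" "x < (1::real)"
  obtains s :: nat where "\<And>t. t \<ge> s \<Longrightarrow> x ^ t \<le> 1 / 2"
proof -
  obtain s where s: "x ^ s < 1 / 2" using real_arch_pow_inv[of "1 / 2" x] assms by auto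
  have "x ^ t \<le> 1 / 2" if "t \<ge> s" for t
    using power_decreasing[OF that, of x] assms s by linarith
  thus ?thesis using that by blast
qed

text \<open>The constant is fixed before D: s and t depend only on the two radii, whereas the size b
  of f and the threshold E0 merely raise the level N at which the induction starts.\<close>

lemma few_algebraic_points:
  fixes f :: "complex \<Rightarrow> complex"
  assumes r: "0 < r" "r < r1" and f: "f holomorphic_on U" "open U" "connected U" "cball 0 r1 \<subseteq> U"
    and trans: "transcendental_on U f"
  shows "\<exists>\<gamma>::nat. \<gamma> > 0 \<and> (\<forall>D\<ge>1. \<forall>N0. \<exists>n\<ge>N0. finite (Sigma_alg D (real n) f r) \<and>
           card (Sigma_alg D (real n) f r) < \<gamma> * D ^ 3 * n ^ 2)"
proof -
  have ratio: "0 \<le> r / r1" "r / r1 < 1" using r by auto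
  obtain s1 where s1: "\<And>t. t \<ge> s1 \<Longrightarrow> (r / r1) ^ t \<le> 1 / 2" using ex_power_le_half[OF ratio] by blast
  obtain s2 :: nat where s2: "1 / (1 - r / r1) < 2 ^ s2" using real_arch_pow[of 2] by auto
  define s where "s = s1 + s2 + 1"
  have s: "s \<ge> 1" by (simp add: s_def)
  have "s \<ge> s1" by (simp add: s_def)
  note rs = s1[OF this]
  have "(2::real) ^ s2 \<le> 2 ^ s" by (intro power_increasing) (auto simp: s_def)
  hence s': "1 / (1 - r / r1) \<le> 2 ^ s" using s2 by linarith
  define \<kappa> where "\<kappa> = 2 * r * r1 / (r1\<^sup>2 + r\<^sup>2)"
  have "(r1 - r)\<^sup>2 > 0" using r by simp
  moreover have "(r1 - r)\<^sup>2 = r1\<^sup>2 + r\<^sup>2 - 2 * r * r1" by (simp add: power2_eq_square algebra_simps)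
  ultimately have "2 * r * r1 < r1\<^sup>2 + r\<^sup>2" by linarith
  moreover have "r1\<^sup>2 + r\<^sup>2 > 0" using r by (simp add: add_pos_pos)
  ultimately have \<kappa>: "0 \<le> \<kappa>" "\<kappa> < 1" using r by (simp_all add: \<kappa>_def)
  obtain t1 where t1: "\<And>t. t \<ge> t1 \<Longrightarrow> \<kappa> ^ t \<le> 1 / 2" using ex_power_le_half[OF \<kappa>] by blast
  define t where "t = t1 + 1"
  have t: "t \<ge> 1" by (simp add: t_def)
  have "t \<ge> t1" by (simp add: t_def)
  note \<kappa>t = t1[OF this]
  have "compact (f ` cball 0 r1)"
    using f by (intro compact_continuous_image continuous_on_subset[OF holomorphic_on_imp_continuous_on]) auto
  then obtain B where B: "\<And>z. z \<in> cball 0 r1 \<Longrightarrow> cmod (f z) \<le> B"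
    by (meson bounded_iff compact_imp_bounded imageI)
  obtain b :: nat where b': "max r1 B < 2 ^ b" using real_arch_pow[of 2 "max r1 B"] by auto
  have b: "\<forall>z\<in>cball 0 r1. cmod z \<le> 2 ^ b \<and> cmod (f z) \<le> 2 ^ b"
  proof
    fix z :: complex assume z: "z \<in> cball 0 r1"
    hence "cmod z \<le> r1" by simp
    thus "cmod z \<le> 2 ^ b \<and> cmod (f z) \<le> 2 ^ b" using B[OF z] b' by linarith
  qed
  obtain E0 where E0: "\<And>E. E \<ge> E0 \<Longrightarrow> 80 * s * E \<le> 2 ^ E" using eventually_linear_le_power2 by blast
  \<comment> \<open>At level n the Schwarz lemma needs 10 t D T (n + 1) = 2400 s t D^3 N (n + 1)
    zeros, and N \<le> n and n + 1 \<le> 2 n double the constant.\<close>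
  define \<gamma> where "\<gamma> = 4800 * s * t"
  have "\<exists>n\<ge>N0. finite (Sigma_alg D (real n) f r) \<and> card (Sigma_alg D (real n) f r) < \<gamma> * D ^ 3 * n ^ 2"
    if D: "D \<ge> 1" for D N0
  proof (rule ccontr)
    assume "\<not> ?thesis"
    hence many: "infinite (Sigma_alg D (real n) f r) \<or> card (Sigma_alg D (real n) f r) \<ge> \<gamma> * D ^ 3 * n ^ 2"
      if "n \<ge> N0" for n using that by (meson not_less)
    \<comment> \<open>One level N and one polynomial P serve the whole induction; only n varies from
      here on.\<close>
    define N where "N = N0 + E0 + s + 2 + 2 * b"
    define T where "T = 240 * s * D ^ 2 * N"
    have N: "N \<ge> 2 + 2 * b" "N \<ge> s + 2" "N \<ge> N0" "N \<ge> 1" by (auto simp: N_def)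
    have NE: "\<forall>E\<ge>N. 80 * s * E \<le> 2 ^ E" using E0 by (simp add: N_def)
    have T1: "T \<ge> 1" using s D N(4) by (simp add: T_def)
    obtain p where aux: "(\<exists>k<T. \<exists>l<T. p k l \<noteq> 0) \<and>
        (\<forall>k<T. \<forall>l<T. \<bar>p k l\<bar> \<le> 2 ^ (T * N)) \<and>
        (\<forall>z\<in>cball 0 r. cmod (\<Sum>k<T. \<Sum>l<T. of_int (p k l) * z ^ k * f z ^ l) * 2 ^ (7 * (D * T * N)) < 1) \<and>
        (\<forall>z\<in>cball 0 r1. cmod (\<Sum>k<T. \<Sum>l<T. of_int (p k l) * z ^ k * f z ^ l) \<le> 2 ^ (2 * (T * N)))"
      using auxiliary_function[OF r f(1,2,4) b s rs s' D N(1,2) NE T_def] by (rule exE)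
    note p1 = conjunct1[OF aux] and p2 = conjunct1[OF conjunct2[OF aux]]
      and small = conjunct1[OF conjunct2[OF conjunct2[OF aux]]]
      and bound = conjunct2[OF conjunct2[OF conjunct2[OF aux]]]
    have p: "\<bar>p k l\<bar> \<le> 2 ^ (T * N)" if "k < T" "l < T" for k l using p2 that by blast
    define F where "F = (\<lambda>z. \<Sum>k<T. \<Sum>l<T. of_int (p k l) * z ^ k * f z ^ l)"
    have Sigma_cball: "Sigma_alg D x f r \<subseteq> cball 0 r" for x by (auto simp: Sigma_alg_def)
    have K_le: "t * (10 * (D * T * (n + 1))) \<le> \<gamma> * D ^ 3 * n ^ 2" if "n \<ge> N" for n
    proof -
      have "t * (10 * (D * T * (n + 1))) = 2400 * s * t * D ^ 3 * (N * (n + 1))"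
        by (simp add: T_def power2_eq_square power3_eq_cube algebra_simps)
      also have "\<dots> \<le> 2400 * s * t * D ^ 3 * (n * (2 * n))"
        using that N(4) by (intro mult_left_mono mult_mono) auto
      also have "\<dots> = \<gamma> * D ^ 3 * n ^ 2" by (simp add: \<gamma>_def power2_eq_square mult_ac)
      finally show ?thesis .
    qed
    have zeros: "\<exists>S. S \<subseteq> {z \<in> cball 0 r. F z = 0} \<and> finite S \<and> card S = t * (10 * (D * T * (n + 1)))"
      if "\<forall>\<alpha>\<in>Sigma_alg D (real n) f r. F \<alpha> = 0" "n \<ge> N" for n
    proof -
      have "infinite (Sigma_alg D (real n) f r) \<or>
          card (Sigma_alg D (real n) f r) \<ge> t * (10 * (D * T * (n + 1)))"
        using many[of n] K_le[OF that(2)] that(2) N(3) by linarith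
      then obtain S where "S \<subseteq> Sigma_alg D (real n) f r" "finite S" "card S = t * (10 * (D * T * (n + 1)))"
        by (rule ex_finite_subset_card)
      moreover from this(1) have "S \<subseteq> {z \<in> cball 0 r. F z = 0}"
        using that(1) Sigma_cball[of "real n"] by auto
      ultimately show ?thesis by (intro exI[of _ S] conjI)
    qed
    have vanish: "\<forall>\<alpha>\<in>Sigma_alg D (real n) f r. F \<alpha> = 0" if "n \<ge> N" for n
      using that
    proof (induction n rule: dec_induct)
      case base
      show ?case
      proof (rule ballI, rule ccontr)
        fix \<alpha> assume \<alpha>: "\<alpha> \<in> Sigma_alg D (real N) f r" and ne: "F \<alpha> \<noteq> 0"
        have "1 \<le> cmod (F \<alpha>) * 2 ^ (7 * (D * T * N))"
          unfolding F_def by (rule liouville_Sigma[OF \<alpha> T1 N(4) order_refl p ne[unfolded F_def]])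
        moreover have "\<alpha> \<in> cball 0 r" using \<alpha> Sigma_cball by blast
        ultimately show False using bspec[OF small, of \<alpha>] unfolding F_def by linarith
      qed
    next
      case (step n)
      obtain S where S: "S \<subseteq> {z \<in> cball 0 r. F z = 0}" "finite S" "card S = t * (10 * (D * T * (n + 1)))"
        using zeros[OF step.IH step.hyps(1)] by blast
      show ?case
      proof
        fix \<alpha> assume \<alpha>: "\<alpha> \<in> Sigma_alg D (real (Suc n)) f r"
        show "F \<alpha> = 0" unfolding F_def
        proof (rule zero_propagation[OF r f(1,2,4) \<kappa>t[unfolded \<kappa>_def] D T1 N(4) step.hyps(1) p bspec[OF bound] S(2) _ _ S(3)])
          show "S \<subseteq> cball 0 r" using S(1) by blast
          show "\<alpha> \<in> Sigma_alg D (real (n + 1)) f r" using \<alpha> by simp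
          show "(\<Sum>k<T. \<Sum>l<T. of_int (p k l) * x ^ k * f x ^ l) = 0" if "x \<in> S" for x
            using S(1) that unfolding F_def by blast
        qed
      qed
    qed
    have "infinite {z \<in> cball 0 r. F z = 0}"
    proof
      assume fin: "finite {z \<in> cball 0 r. F z = 0}"
      \<comment> \<open>Level n provides more than n zeros, so n is taken at least as large as their
        supposed number.\<close>
      define n where "n = N + card {z \<in> cball 0 r. F z = 0}"
      have "n \<ge> N" by (simp add: n_def)
      from zeros[OF vanish[OF this] this]
      obtain S where S: "S \<subseteq> {z \<in> cball 0 r. F z = 0}" "card S = t * (10 * (D * T * (n + 1)))"
        by (elim exE conjE)
      have "n < 1 * (10 * (1 * 1 * (n + 1)))" by simp
      also have "\<dots> \<le> card S" unfolding S(2) using t D T1 by (intro mult_le_mono) auto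
      also have "\<dots> \<le> card {z \<in> cball 0 r. F z = 0}" using S(1) by (rule card_mono[OF fin])
      finally show False by (simp add: n_def)
    qed
    then obtain \<xi> where \<xi>: "\<xi> \<in> cball 0 r" "\<xi> islimpt {z \<in> cball 0 r. F z = 0}"
      using compact_eq_Bolzano_Weierstrass[of "cball (0::complex) r"] by auto
    have rU: "cball 0 r \<subseteq> U" using r f(4) by auto
    have hol: "F holomorphic_on U" unfolding F_def by (intro holomorphic_intros f)
    have "F z = 0" if "z \<in> U" for z
    proof (rule analytic_continuation[OF hol f(2,3) _ _ \<xi>(2) _ that])
      show "{z \<in> cball 0 r. F z = 0} \<subseteq> U" using rU by blast
      show "\<xi> \<in> U" using \<xi>(1) rU by blast
    qed simp
    hence "of_int (p k l) = (0::complex)" if "k < T" "l < T" for k l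
      unfolding F_def by (intro transcendental_imp_coeffs_0[OF trans _ that, of "\<lambda>k l. of_int (p k l)"])
    thus False using p1 by auto
  qed
  moreover have "\<gamma> > 0" using s t by (simp add: \<gamma>_def)
  ultimately show ?thesis by blast
qed

theorem mainTheorem2:
  fixes R :: ereal and r :: real and f :: "complex \<Rightarrow> complex"
  assumes "0 < r" and "ereal r < R"
    and "f holomorphic_on eball 0 R"
    and "transcendental_on (eball 0 R) f"
  shows "\<exists>\<gamma>::real. \<gamma> > 0 \<and>
           (\<forall>D::nat. D \<ge> 1 \<longrightarrow>
              infinite {N::real. N \<ge> 0 \<and> finite (Sigma_alg D N f r) \<and>
                 real (card (Sigma_alg D N f r)) < \<gamma> * real D ^ 3 * N ^ 2})"
proof -
  \<comment> \<open>f may be unbounded on the whole disc; an intermediate radius provides a compact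
    disc on which it is bounded, also when R is infinite.\<close>
  obtain r1 where r1: "r < r1" "ereal r1 < R" using ereal_dense2[OF assms(2)] by auto
  have "eball (0::complex) R = UNIV \<or> (\<exists>x. eball (0::complex) R = ball 0 x)"
    using r1 assms(1) by (cases R) auto
  hence U: "open (eball (0::complex) R)" "connected (eball (0::complex) R)" by auto
  have sub: "cball 0 r1 \<subseteq> eball (0::complex) R"
  proof
    fix z :: complex assume "z \<in> cball 0 r1"
    hence "ereal (cmod z) \<le> ereal r1" by simp
    hence "ereal (cmod z) < R" using r1(2) by (rule le_less_trans)
    thus "z \<in> eball 0 R" by simp
  qed
  obtain \<gamma> :: nat where \<gamma>: "\<gamma> > 0" and few: "\<And>D N0. D \<ge> 1 \<Longrightarrow> \<exists>n\<ge>N0. finite (Sigma_alg D (real n) f r) \<and>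
           card (Sigma_alg D (real n) f r) < \<gamma> * D ^ 3 * n ^ 2"
    using few_algebraic_points[OF assms(1) r1(1) assms(3) U sub assms(4)] by blast
  have "infinite {N::real. N \<ge> 0 \<and> finite (Sigma_alg D N f r) \<and>
      real (card (Sigma_alg D N f r)) < real \<gamma> * real D ^ 3 * N ^ 2}" (is "infinite ?A")
    if D: "D \<ge> 1" for D
  proof -
    \<comment> \<open>Natural numbers N already suffice: arbitrarily large ones exist, and
      \<open>real\<close> is injective.\<close>
    define B where "B = {n. finite (Sigma_alg D (real n) f r) \<and>
           card (Sigma_alg D (real n) f r) < \<gamma> * D ^ 3 * n ^ 2}"
    have "infinite B" unfolding infinite_nat_iff_unbounded_le
    proof
      fix m
      obtain n where "n \<ge> m" "finite (Sigma_alg D (real n) f r)"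
        "card (Sigma_alg D (real n) f r) < \<gamma> * D ^ 3 * n ^ 2"
        using few[OF D, of m] by (elim exE conjE)
      thus "\<exists>n\<ge>m. n \<in> B" unfolding B_def mem_Collect_eq by (intro exI[of _ n] conjI)
    qed
    moreover have "inj_on real B" by (simp add: inj_on_def)
    ultimately have "infinite (real ` B)" by (simp only: finite_image_iff not_False_eq_True)
    moreover have "real ` B \<subseteq> ?A"
    proof (rule image_subsetI)
      fix n assume "n \<in> B"
      hence fin: "finite (Sigma_alg D (real n) f r)"
        and less: "card (Sigma_alg D (real n) f r) < \<gamma> * D ^ 3 * n ^ 2"
        by (simp_all only: B_def mem_Collect_eq)
      have "real (card (Sigma_alg D (real n) f r)) < real (\<gamma> * D ^ 3 * n ^ 2)"
        using less by (simp only: of_nat_less_iff)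
      also have "\<dots> = real \<gamma> * real D ^ 3 * real n ^ 2" by simp
      finally show "real n \<in> ?A" unfolding mem_Collect_eq using fin by (intro conjI of_nat_0_le_iff)
    qed
    ultimately show ?thesis using infinite_super by blast
  qed
  moreover have "real \<gamma> > 0" using \<gamma> by simp
  ultimately show ?thesis by (intro exI[of _ "real \<gamma>"] conjI allI impI)
qed

end
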